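(* Let $Q=(q_n)_{n=1}^\infty$ be an eventually periodic basic sequence with period $(c_1, c_2, \ldots, c_m)$. Set $b = \prod_{i=1}^m c_i$ and let $g\ge 2$ be an integer with $g \sim b$, i.e. such that $\frac{\log g}{\log b}$ is rational. Then for any real number $x$, the following are equivalent: (1) $x$ is normal in base $g$; (2) $x$ is $Q$-normal; (3) $x$ is $Q$-distribution normal.
   Context: A basic sequence is a sequence $Q=(q_n)_{n=1}^\infty$ of integers $q_n\ge 2$. An eventually periodic basic sequence $Q$ has period $(c_1,\ldots,c_m)$ if $Q$ can be written as $(d_1,\ldots,d_k,\overline{c_1,\ldots,c_m})$, i.e. finitely many initial terms $d_1,\ldots,d_k$ ($k\ge 0$) followed by the block $c_1,\ldots,c_m$ repeated forever (the period need not be of minimal length). The $Q$-Cantor series expansion of a real number $x$ is the unique expansion $x=E_0+\sum_{n=1}^\infty \frac{E_n}{q_1q_2\cdots q_n}$ with $E_0=\lfloor x\rfloor$ and $E_n\in\{0,1,\ldots,q_n-1\}$ for $n\ge1$, with $E_n\ne q_n-1$ for infinitely many $n$. A block is a finite tuple $B=(b_1,\ldots,b_k)$ of non-negative integers. For a natural number $j\ge 1$ let $\mathcal{I}_{Q,j}(B)=1$ if $b_1<q_j,\ b_2<q_{j+1},\ \ldots,\ b_k<q_{j+k-1}$, and $\mathcal{I}_{Q,j}(B)=0$ otherwise. Let $Q_n(B)=\sum_{j=1}^n \frac{\mathcal{I}_{Q,j}(B)}{q_jq_{j+1}\cdots q_{j+k-1}}$. Let $N_n^Q(B,x)$ be the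 number of occurrences of the block $B$ (as consecutive digits) in the sequence $(E_i)_{i=1}^n$ of the first $n$ digits of the $Q$-Cantor series expansion of $x$. A real number $x$ is $Q$-normal if for all blocks $B$ such that $\lim_{n\to\infty}Q_n(B)=\infty$ we have $\lim_{n\to\infty}\frac{N_n^Q(B,x)}{Q_n(B)}=1$. Let $T_{Q,n}(x)=q_nq_{n-1}\cdots q_1x \pmod 1$ (with $T_{Q,0}(x)=x \bmod 1$). A real number $x$ is $Q$-distribution normal if the sequence $(T_{Q,n}(x))_{n=0}^\infty$ is uniformly distributed mod $1$. Normality in base $g$ is the usual notion; equivalently, $(g^nx)_{n=0}^\infty$ is uniformly distributed mod $1$. *)

theory Defs
  imports "HOL-Analysis.Analysis"
begin

text \<open>
  Sequences are indexed from 1 as functions on \<^typ>\<open>nat\<close>; the value \<open>Q 0\<close> is never used.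
\<close>

definition basic_sequence :: "(nat \<Rightarrow> nat) \<Rightarrow> bool" where
  "basic_sequence Q \<longleftrightarrow> (\<forall>n\<ge>1. Q n \<ge> 2)"

text \<open>\<open>Q\<close> can be written as \<open>d\<^sub>1, \<dots>, d\<^sub>k\<close> followed by the block \<open>c\<close> repeated forever.\<close>

definition eventually_periodic_with :: "(nat \<Rightarrow> nat) \<Rightarrow> nat list \<Rightarrow> bool" where
  "eventually_periodic_with Q c \<longleftrightarrow>
     c \<noteq> [] \<and>
     (\<exists>d. (\<forall>i<length d. Q (i + 1) = d ! i) \<and>
          (\<forall>i. Q (length d + i + 1) = c ! (i mod length c)))"

definition is_cantor_expansion :: "(nat \<Rightarrow> nat) \<Rightarrow> real \<Rightarrow> (nat \<Rightarrow> int) \<Rightarrow> bool" where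
  "is_cantor_expansion Q x E \<longleftrightarrow>
     E 0 = \<lfloor>x\<rfloor> \<and>
     (\<forall>n\<ge>1. 0 \<le> E n \<and> E n \<le> int (Q n) - 1) \<and>
     infinite {n. n \<ge> 1 \<and> E n \<noteq> int (Q n) - 1} \<and>
     (\<lambda>n. of_int (E (Suc n)) / real (\<Prod>i=1..Suc n. Q i)) sums (x - of_int (E 0))"

text \<open>
  The expansion exists and is unique for every basic sequence; see
  \<open>cantor_expansion_unique\<close> below.
\<close>

definition cantor_digit :: "(nat \<Rightarrow> nat) \<Rightarrow> real \<Rightarrow> nat \<Rightarrow> int" where
  "cantor_digit Q x = (THE E. is_cantor_expansion Q x E)"

definition block_indicator :: "(nat \<Rightarrow> nat) \<Rightarrow> nat \<Rightarrow> nat list \<Rightarrow> real" where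
  "block_indicator Q j B = (if \<forall>i<length B. B ! i < Q (j + i) then 1 else 0)"

definition expected_count :: "(nat \<Rightarrow> nat) \<Rightarrow> nat \<Rightarrow> nat list \<Rightarrow> real" where
  "expected_count Q n B =
     (\<Sum>j=1..n. block_indicator Q j B / real (\<Prod>i<length B. Q (j + i)))"

text \<open>An occurrence starting at \<open>j\<close> must lie entirely within the first \<open>n\<close> digits.\<close>

definition block_count :: "(nat \<Rightarrow> nat) \<Rightarrow> nat \<Rightarrow> nat list \<Rightarrow> real \<Rightarrow> nat" where
  "block_count Q n B x =
     card {j. 1 \<le> j \<and> j + length B \<le> n + 1 \<and>
              (\<forall>i<length B. cantor_digit Q x (j + i) = int (B ! i))}"

definition Q_normal :: "(nat \<Rightarrow> nat) \<Rightarrow> real \<Rightarrow> bool" where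
  "Q_normal Q x \<longleftrightarrow>
     (\<forall>B. B \<noteq> [] \<longrightarrow> filterlim (\<lambda>n. expected_count Q n B) at_top sequentially \<longrightarrow>
        (\<lambda>n. real (block_count Q n B x) / expected_count Q n B) \<longlonglongrightarrow> 1)"

definition uniformly_distributed_mod1 :: "(nat \<Rightarrow> real) \<Rightarrow> bool" where
  "uniformly_distributed_mod1 u \<longleftrightarrow>
     (\<forall>a b. 0 \<le> a \<longrightarrow> a < b \<longrightarrow> b \<le> 1 \<longrightarrow>
        (\<lambda>N. real (card {n. n < N \<and> a \<le> frac (u n) \<and> frac (u n) < b}) / real N)
          \<longlonglongrightarrow> b - a)"

definition T_map :: "(nat \<Rightarrow> nat) \<Rightarrow> nat \<Rightarrow> real \<Rightarrow> real" where
  "T_map Q n x = frac (real (\<Prod>i=1..n. Q i) * x)"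

definition Q_distribution_normal :: "(nat \<Rightarrow> nat) \<Rightarrow> real \<Rightarrow> bool" where
  "Q_distribution_normal Q x \<longleftrightarrow> uniformly_distributed_mod1 (\<lambda>n. T_map Q n x)"

text \<open>
  Every block of base-\<open>g\<close> digits of length \<open>k\<close> has asymptotic frequency \<open>g\<^sup>-\<^sup>k\<close>. The base-\<open>g\<close>
  expansion is the Cantor series expansion for the constant sequence \<open>g\<close>.
\<close>

definition normal_in_base :: "nat \<Rightarrow> real \<Rightarrow> bool" where
  "normal_in_base g x \<longleftrightarrow>
     (\<forall>B. B \<noteq> [] \<longrightarrow> set B \<subseteq> {..<g} \<longrightarrow>
        (\<lambda>n. real (block_count (\<lambda>_. g) n B x) / real n) \<longlonglongrightarrow> 1 / real g ^ length B)"

lemma floor_mult_nat_bounds: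
  fixes y :: real and q :: nat
  assumes "q \<ge> 1"
  shows "0 \<le> \<lfloor>of_nat q * y\<rfloor> - int q * \<lfloor>y\<rfloor>" "\<lfloor>of_nat q * y\<rfloor> - int q * \<lfloor>y\<rfloor> \<le> int q - 1"
proof -
  have "real q * of_int \<lfloor>y\<rfloor> \<le> real q * y" by (intro mult_left_mono) auto
  then have "of_int (int q * \<lfloor>y\<rfloor>) \<le> real q * y" by simp
  then show "0 \<le> \<lfloor>of_nat q * y\<rfloor> - int q * \<lfloor>y\<rfloor>" by (simp only: le_floor_iff diff_ge_0_iff_ge)
  have "y < of_int \<lfloor>y\<rfloor> + 1" by linarith
  then have "real q * y < real q * (of_int \<lfloor>y\<rfloor> + 1)" using assms by (intro mult_strict_left_mono) auto
  then have "real q * y < of_int (int q * \<lfloor>y\<rfloor> + int q)" by (simp add: algebra_simps)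
  then have "\<lfloor>real q * y\<rfloor> < int q * \<lfloor>y\<rfloor> + int q" by (simp only: floor_less_iff)
  then show "\<lfloor>of_nat q * y\<rfloor> - int q * \<lfloor>y\<rfloor> \<le> int q - 1" by simp
qed

lemma cantor_expansion_unique:
  assumes Q: "basic_sequence Q"
  shows "\<exists>!E. is_cantor_expansion Q x E"
proof -
  define P where "P n = real (\<Prod>i=1..n. Q i)" for n
  have Q2: "Q (Suc n) \<ge> 2" for n using Q by (auto simp: basic_sequence_def)
  have P0: "P 0 = 1" by (simp add: P_def)
  have PS: "P (Suc n) = real (Q (Suc n)) * P n" for n
    by (simp add: P_def mult.commute)
  have P_pow: "P n \<ge> 2 ^ n" for n
  proof (induction n)
    case (Suc n)
    then show ?case unfolding PS power_Suc using Q2[of n] by (intro mult_mono) auto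
  qed (simp add: P0)
  have P_pos: "P n > 0" for n using P_pow[of n] by (smt (verit) zero_less_power)
  define a where "a E n = (of_int (E (Suc n)) / P (Suc n) :: real)" for E :: "nat \<Rightarrow> int" and n
  have ex_def: "is_cantor_expansion Q x E \<longleftrightarrow> E 0 = \<lfloor>x\<rfloor> \<and>
     (\<forall>n\<ge>1. 0 \<le> E n \<and> E n \<le> int (Q n) - 1) \<and>
     infinite {n. n \<ge> 1 \<and> E n \<noteq> int (Q n) - 1} \<and> a E sums (x - of_int (E 0))" for E
    unfolding is_cantor_expansion_def a_def P_def by simp
  have escape: False
    if r: "\<And>n. n \<ge> N \<Longrightarrow> r (Suc n) = real (Q (Suc n)) * r n"
      and le: "\<And>n. r n \<le> 1" and pos: "r N > 0" for r :: "nat \<Rightarrow> real" and N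
  proof -
    have ge: "r (N + k) \<ge> 2 ^ k * r N" for k
    proof (induction k)
      case (Suc k)
      have "2 * (2 ^ k * r N) \<le> real (Q (Suc (N + k))) * r (N + k)"
        using Suc Q2[of "N + k"] pos by (intro mult_mono) auto
      then show ?case using r[of "N + k"] by simp
    qed simp
    obtain k where "1 / r N < 2 ^ k" using real_arch_pow[of 2 "1 / r N"] by auto
    then have "1 < 2 ^ k * r N" using pos by (simp add: field_simps)
    with ge[of k] le[of "N + k"] show False by linarith
  qed
  define F where "F n = (if n = 0 then \<lfloor>x\<rfloor> else \<lfloor>P n * x\<rfloor> - int (Q n) * \<lfloor>P (n - 1) * x\<rfloor>)" for n
  have FS: "F (Suc n) = \<lfloor>P (Suc n) * x\<rfloor> - int (Q (Suc n)) * \<lfloor>P n * x\<rfloor>" for n by (simp add: F_def)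
  have "is_cantor_expansion Q x F"
    unfolding ex_def
  proof (intro conjI allI impI)
    show "F 0 = \<lfloor>x\<rfloor>" by (simp add: F_def)
    fix n :: nat assume "n \<ge> 1"
    then obtain m where n: "n = Suc m" by (cases n) auto
    show "0 \<le> F n" "F n \<le> int (Q n) - 1"
      using floor_mult_nat_bounds[of "Q (Suc m)" "P m * x"] Q2[of m]
      unfolding n FS PS by (simp_all add: mult.assoc)
  next
    show "infinite {n. n \<ge> 1 \<and> F n \<noteq> int (Q n) - 1}"
    proof
      assume "finite {n. n \<ge> 1 \<and> F n \<noteq> int (Q n) - 1}"
      then obtain N where N: "\<And>n. n \<in> {n. n \<ge> 1 \<and> F n \<noteq> int (Q n) - 1} \<Longrightarrow> n \<le> N"
        using finite_nat_set_iff_bounded_le by auto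
      define r where "r n = 1 - frac (P n * x)" for n
      show False
      proof (rule escape[of N r])
        fix n assume "n \<ge> N"
        then have "F (Suc n) = int (Q (Suc n)) - 1" using N[of "Suc n"] by force
        then have "\<lfloor>P (Suc n) * x\<rfloor> = int (Q (Suc n)) * \<lfloor>P n * x\<rfloor> + int (Q (Suc n)) - 1"
          unfolding FS by simp
        then have "real_of_int \<lfloor>P (Suc n) * x\<rfloor>
            = of_int (int (Q (Suc n)) * \<lfloor>P n * x\<rfloor> + int (Q (Suc n)) - 1)"
          by (rule arg_cong)
        then have "real_of_int \<lfloor>P (Suc n) * x\<rfloor>
            = real (Q (Suc n)) * of_int \<lfloor>P n * x\<rfloor> + real (Q (Suc n)) - 1"
          by simp
        moreover have "P (Suc n) * x = real (Q (Suc n)) * (P n * x)" by (simp add: PS)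
        ultimately show "r (Suc n) = real (Q (Suc n)) * r n"
          unfolding r_def frac_def right_diff_distrib by linarith
      next
        show "r n \<le> 1" for n by (simp add: r_def)
        show "r N > 0" by (simp add: r_def frac_lt_1)
      qed
    qed
  next
    have part: "(\<Sum>k<n. a F k) = of_int \<lfloor>P n * x\<rfloor> / P n - of_int \<lfloor>x\<rfloor>" for n
    proof (induction n)
      case (Suc n)
      have "a F n = of_int \<lfloor>P (Suc n) * x\<rfloor> / P (Suc n) - of_int \<lfloor>P n * x\<rfloor> / P n"
        using P_pos[of n] Q2[of n] unfolding a_def FS by (simp add: PS field_simps)
      with Suc show ?case by simp
    qed (simp add: P0)
    have "(\<lambda>n. of_int \<lfloor>P n * x\<rfloor> / P n - x) \<longlonglongrightarrow> 0"
    proof (rule Lim_null_comparison)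
      show "(\<lambda>n. (1 / 2) ^ n :: real) \<longlonglongrightarrow> 0" by (rule LIMSEQ_realpow_zero) auto
      have "norm (of_int \<lfloor>P n * x\<rfloor> / P n - x) \<le> (1 / 2) ^ n" for n
      proof -
        have "of_int \<lfloor>P n * x\<rfloor> / P n - x = - frac (P n * x) / P n"
          using P_pos[of n] by (simp add: frac_def field_simps)
        then have "norm (of_int \<lfloor>P n * x\<rfloor> / P n - x) = frac (P n * x) / P n"
          using P_pos[of n] by (simp add: abs_div)
        also have "\<dots> \<le> 1 / 2 ^ n"
          using P_pow[of n] P_pos[of n] frac_lt_1[of "P n * x"] by (intro frac_le) auto
        finally show ?thesis by (simp add: power_divide)
      qed
      then show "\<forall>\<^sub>F n in sequentially. norm (of_int \<lfloor>P n * x\<rfloor> / P n - x) \<le> (1 / 2) ^ n"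
        by simp
    qed
    then have "(\<lambda>n. of_int \<lfloor>P n * x\<rfloor> / P n - of_int \<lfloor>x\<rfloor>) \<longlonglongrightarrow> x - of_int \<lfloor>x\<rfloor>"
      by (intro tendsto_diff tendsto_const) (simp add: LIM_zero_iff)
    then show "a F sums (x - of_int (F 0))" unfolding sums_def part by (simp add: F_def)
  qed
  moreover have "E = F" if E: "is_cantor_expansion Q x E" for E
  proof -
    from E have E0: "E 0 = \<lfloor>x\<rfloor>" and bds: "\<And>n. 0 \<le> E (Suc n) \<and> E (Suc n) \<le> int (Q (Suc n)) - 1"
      and inf: "infinite {n. n \<ge> 1 \<and> E n \<noteq> int (Q n) - 1}"
      and sums: "a E sums (x - of_int \<lfloor>x\<rfloor>)" unfolding ex_def by auto
    define r where "r n = P n * (x - of_int \<lfloor>x\<rfloor> - (\<Sum>k<n. a E k))" for n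
    have a0: "a E n \<ge> 0" for n using bds[of n] P_pos[of "Suc n"] by (simp add: a_def)
    have a1: "a E n \<le> 1 / P n - 1 / P (Suc n)" for n
    proof -
      have "real_of_int (E (Suc n)) \<le> real (Q (Suc n)) - 1" using bds[of n] by linarith
      then have "a E n \<le> (real (Q (Suc n)) - 1) / P (Suc n)"
        unfolding a_def using P_pos[of "Suc n"] by (intro divide_right_mono) auto
      also have "\<dots> = 1 / P n - 1 / P (Suc n)"
        using P_pos[of n] Q2[of n] by (simp add: PS field_simps)
      finally show ?thesis .
    qed
    have r0: "r n \<ge> 0" for n
      using sum_le_suminf[OF sums_summable[OF sums], of "{..<n}"] a0 sums_unique[OF sums] P_pos[of n]
      by (simp add: r_def)
    have r1: "r n \<le> 1" for n
    proof -
      have "(\<Sum>k<n + m. a E k) \<le> (\<Sum>k<n. a E k) + 1 / P n - 1 / P (n + m)" for m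
      proof (induction m)
        case (Suc m)
        then show ?case using a1[of "n + m"] by simp
      qed simp
      then have "(\<Sum>k<m + n. a E k) \<le> (\<Sum>k<n. a E k) + 1 / P n" for m
        using P_pos[of "n + m"] by (smt (verit) add.commute divide_nonneg_pos)
      moreover have "(\<lambda>m. \<Sum>k<m + n. a E k) \<longlonglongrightarrow> x - of_int \<lfloor>x\<rfloor>"
        using sums unfolding sums_def by (rule LIMSEQ_ignore_initial_segment)
      ultimately have "x - of_int \<lfloor>x\<rfloor> \<le> (\<Sum>k<n. a E k) + 1 / P n"
        by (intro LIMSEQ_le_const2) auto
      then have "x - of_int \<lfloor>x\<rfloor> - (\<Sum>k<n. a E k) \<le> 1 / P n" by simp
      then show ?thesis using P_pos[of n] by (simp add: r_def field_simps)
    qed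
    have rS: "r (Suc n) = real (Q (Suc n)) * r n - of_int (E (Suc n))" for n
    proof -
      have "P (Suc n) * a E n = of_int (E (Suc n))" using P_pos[of "Suc n"] by (simp add: a_def)
      then show ?thesis by (simp add: r_def PS algebra_simps)
    qed
    have "r n < 1" for n
    proof (rule ccontr)
      assume "\<not> r n < 1"
      then have rn: "r n = 1" using r1[of n] by simp
      have step: "E (Suc m) = int (Q (Suc m)) - 1" if "r m = 1" for m
      proof -
        have "real (Q (Suc m)) - of_int (E (Suc m)) \<le> 1" using rS[of m] r1[of "Suc m"] that by simp
        then show ?thesis using bds[of m] by linarith
      qed
      have "r (n + k) = 1" for k
      proof (induction k)
        case (Suc k)
        then show ?case using step[of "n + k"] rS[of "n + k"] by simp
      qed (use rn in simp)
      then have "E (Suc (n + k)) = int (Q (Suc (n + k))) - 1" for k using step by blast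
      then have "{m. m \<ge> 1 \<and> E m \<noteq> int (Q m) - 1} \<subseteq> {..n}"
        by (smt (verit) atMost_iff less_imp_Suc_add mem_Collect_eq not_le subsetI)
      then show False using inf finite_subset by blast
    qed
    have fl: "P n * x - r n = of_int \<lfloor>P n * x\<rfloor>" for n
    proof -
      have "\<exists>z. P n * x - r n = of_int z"
      proof (induction n)
        case 0
        show ?case by (simp add: r_def P0)
      next
        case (Suc n)
        then obtain z where "P n * x - r n = of_int z" by blast
        then have rn: "r n = P n * x - of_int z" by linarith
        have "P (Suc n) * x - r (Suc n) = of_int (int (Q (Suc n)) * z + E (Suc n))"
          unfolding rS rn by (simp add: PS algebra_simps)
        then show ?case by blast
      qed
      then obtain z where z: "P n * x - r n = of_int z" by blast
      then have "\<lfloor>P n * x\<rfloor> = z" using r0[of n] \<open>r n < 1\<close> by (intro floor_unique) linarith+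
      with z show ?thesis by simp
    qed
    have "E n = F n" for n
    proof (cases n)
      case 0
      then show ?thesis using E0 by (simp add: F_def)
    next
      case (Suc m)
      have rm: "r m = P m * x - of_int \<lfloor>P m * x\<rfloor>" using fl[of m] by linarith
      have "real_of_int (E (Suc m)) = real (Q (Suc m)) * r m - r (Suc m)" using rS[of m] by simp
      also have "\<dots> = of_int (F (Suc m))"
        using fl[of "Suc m"] unfolding rm FS by (simp add: PS algebra_simps)
      finally show ?thesis using Suc by simp
    qed
    then show ?thesis by blast
  qed
  ultimately show ?thesis by blast
qed

end

theory Submission
  imports Defs
begin

text \<open>
  All three properties are equivalent to the uniform distribution modulo 1 of the sequence
  \<open>b ^ n * x\<close>. Along a residue class of indices modulo the period, the products
  \<open>q\<^sub>1 \<cdots> q\<^sub>n\<close> form a geometric progression with ratio \<open>b\<close>, so the orbit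
  \<open>T\<^sub>Q\<^sub>,\<^sub>n x\<close> is interleaved from finitely many orbits under multiplication by \<open>b\<close>, which start
  at integer multiples of \<open>x\<close>.

  One direction is a computation. Integer multiples of a uniformly distributed sequence are
  uniformly distributed (\<open>uniformly_distributed_nat_mult\<close>), so each of the interleaved orbits is,
  and hence so is the whole sequence (\<open>has_mean_residues\<close>). A digit block occurs exactly when the
  orbit visits an interval whose length is the expected frequency of the block
  (\<open>block_occurs_iff\<close>), and this gives \<open>Q\<close>-normality.

  In the other direction, a property of the interleaved sequence says little about its parts:
  densities add up over the residue classes and the summands could be different. However, each part
  has at most the density of the whole, so visits to a base-\<open>b\<close> interval of length
  \<open>1 / b ^ k\<close> have upper density at most a constant times \<open>1 / b ^ k\<close>. By the criterion of
  Pyatetskii-Shapiro (\<open>uniformly_distributed_if_bounded_visits\<close>) such a bound implies uniform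
  distribution. The proof of the criterion is a variance estimate: among all words of \<open>L\<close> digits,
  those with an atypical frequency of a given digit block have proportion tending to 0 as \<open>L\<close>
  grows, and by hypothesis they make up at most a constant times this proportion of the orbit.
  The bound also passes from a multiple of \<open>x\<close> to \<open>x\<close> (\<open>bounded_visits_of_multiple\<close>), which
  takes care of the initial part of \<open>Q\<close>.

  The result for eventually periodic sequences applies to constant sequences too. Normality in base
  \<open>g\<close> is \<open>Q\<close>-normality for the constant sequence \<open>g\<close>, and regarding this sequence as having
  period \<open>k\<close> shows that bases \<open>g\<close> and \<open>g ^ k\<close> define the same property. This settles
  multiplicatively dependent bases, as \<open>g ^ q = b ^ p\<close> for some positive \<open>p\<close> and \<open>q\<close>.
\<close>

section \<open>Asymptotic means\<close>

text \<open>
  Counting problems are treated as means of sequences of the form \<open>of_bool (P n)\<close>, for which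
  the mean is the asymptotic density of \<open>P\<close>; finite sums and differences of counts then need
  no bookkeeping with cardinalities.
\<close>

definition has_mean :: "(nat \<Rightarrow> real) \<Rightarrow> real \<Rightarrow> bool" where
  "has_mean f L \<longleftrightarrow> (\<lambda>N. (\<Sum>n<N. f n) / real N) \<longlonglongrightarrow> L"

lemma has_mean_const: "has_mean (\<lambda>_. c) c"
  unfolding has_mean_def
  by (rule tendsto_eventually, rule eventually_sequentiallyI[of 1]) simp

lemma has_mean_diff:
  assumes "has_mean f L" "has_mean g M"
  shows "has_mean (\<lambda>n. f n - g n) (L - M)"
  using tendsto_diff[OF assms[unfolded has_mean_def]]
  by (simp add: has_mean_def sum_subtractf diff_divide_distrib)

lemma has_mean_sum:
  assumes "\<And>i. i \<in> I \<Longrightarrow> has_mean (f i) (L i)"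
  shows "has_mean (\<lambda>n. \<Sum>i\<in>I. f i n) (\<Sum>i\<in>I. L i)"
proof -
  have "(\<lambda>N. \<Sum>i\<in>I. (\<Sum>n<N. f i n) / real N) \<longlonglongrightarrow> (\<Sum>i\<in>I. L i)"
    using assms by (intro tendsto_sum) (auto simp: has_mean_def)
  moreover have "(\<Sum>i\<in>I. (\<Sum>n<N. f i n) / real N) = (\<Sum>n<N. \<Sum>i\<in>I. f i n) / real N" for N
    by (subst sum.swap) (simp add: sum_divide_distrib)
  ultimately show ?thesis by (simp add: has_mean_def)
qed

lemma mean_bounded_error:
  fixes s s' :: "nat \<Rightarrow> real"
  assumes "(\<lambda>N. s N / real N) \<longlonglongrightarrow> L" "\<And>N. \<bar>s' N - s N\<bar> \<le> K"
  shows "(\<lambda>N. s' N / real N) \<longlonglongrightarrow> L"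
proof -
  have "(\<lambda>N. (s' N - s N) / real N) \<longlonglongrightarrow> 0"
  proof (rule Lim_null_comparison)
    show "\<forall>\<^sub>F N in sequentially. norm ((s' N - s N) / real N) \<le> K / real N"
      using assms(2) by (auto simp: abs_div divide_right_mono)
    show "(\<lambda>N. K / real N) \<longlonglongrightarrow> 0" by (rule lim_const_over_n)
  qed
  from tendsto_add[OF this assms(1)] show ?thesis
    by (simp add: diff_divide_distrib)
qed

lemma has_mean_squeeze:
  assumes "\<And>e. e > 0 \<Longrightarrow> \<exists>g l h u. has_mean g l \<and> has_mean h u \<and> L - e < l \<and> u < L + e \<and>
             (\<forall>n. g n \<le> f n \<and> f n \<le> h n)"
  shows "has_mean f L"
  unfolding has_mean_def
proof (rule order_tendstoI)
  fix a assume "a < L"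
  with assms[of "L - a"] obtain g l where g: "has_mean g l" "a < l" "\<And>n. g n \<le> f n" by auto
  have "\<forall>\<^sub>F N in sequentially. a < (\<Sum>n<N. g n) / real N"
    using g by (auto simp: has_mean_def intro: order_tendstoD)
  then show "\<forall>\<^sub>F N in sequentially. a < (\<Sum>n<N. f n) / real N"
    by eventually_elim (meson divide_right_mono g(3) less_le_trans of_nat_0_le_iff sum_mono)
next
  fix a assume "L < a"
  with assms[of "a - L"] obtain h u where h: "has_mean h u" "u < a" "\<And>n. f n \<le> h n" by auto
  have "\<forall>\<^sub>F N in sequentially. (\<Sum>n<N. h n) / real N < a"
    using h by (auto simp: has_mean_def intro: order_tendstoD)
  then show "\<forall>\<^sub>F N in sequentially. (\<Sum>n<N. f n) / real N < a"
    by eventually_elim (meson divide_right_mono h(3) le_less_trans of_nat_0_le_iff sum_mono)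
qed

lemma sum_progression:
  fixes f :: "nat \<Rightarrow> real"
  shows "(\<Sum>n<d + m * t. f n) = (\<Sum>n<d. f n) + (\<Sum>s<t. \<Sum>r<m. f (d + m * s + r))"
proof (induction t)
  case (Suc t)
  have "(\<Sum>n<M + k. f n) = (\<Sum>n<M. f n) + (\<Sum>r<k. f (M + r))" for M k
    by (induction k) simp_all
  from this[of "d + m * t" m] Suc show ?case by (simp add: algebra_simps)
qed simp

text \<open>
  A density may be computed separately on the residue classes modulo \<open>m\<close>, after a finite
  initial segment. Up to a bounded error, the sum over \<open>N\<close> terms is a sum over complete
  groups of \<open>m\<close> consecutive terms, one from each class, and there are about \<open>N / m\<close> such groups.
\<close>

lemma has_mean_residues:
  assumes "m > 0" and bdd: "\<And>n. \<bar>f n\<bar> \<le> 1"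
    and "\<And>r. r < m \<Longrightarrow> has_mean (\<lambda>t. f (d + m * t + r)) (L r)"
  shows "has_mean f ((\<Sum>r<m. L r) / real m)"
proof -
  define h where "h s = (\<Sum>r<m. f (d + m * s + r))" for s
  have mean_h: "has_mean h (\<Sum>r<m. L r)"
    unfolding h_def by (rule has_mean_sum) (use assms in auto)
  define t where "t N = (N - d) div m" for N
  have t_lim: "filterlim t sequentially sequentially"
    unfolding filterlim_at_top
  proof
    fix Z
    show "\<forall>\<^sub>F N in sequentially. Z \<le> t N"
    proof (rule eventually_sequentiallyI[of "d + m * Z"])
      fix N assume "d + m * Z \<le> N"
      then have "m * Z \<le> N - d" by simp
      then show "Z \<le> t N" using \<open>m > 0\<close>
        by (simp add: t_def less_eq_div_iff_mult_less_eq mult.commute)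
    qed
  qed
  have ratio: "(\<lambda>N. real (t N) / real N) \<longlonglongrightarrow> 1 / real m"
  proof (rule mean_bounded_error)
    show "(\<lambda>N. (real N / real m) / real N) \<longlonglongrightarrow> 1 / real m"
      by (rule tendsto_eventually, rule eventually_sequentiallyI[of 1]) simp
    fix N
    show "\<bar>real (t N) - real N / real m\<bar> \<le> real d + 1"
    proof -
      have "(N - d) = m * t N + (N - d) mod m" "(N - d) mod m < m"
        using \<open>m > 0\<close> by (auto simp: t_def)
      then have "m * t N \<le> N" "N \<le> m * t N + m + d" by linarith+
      then have "real m * real (t N) \<le> real N" "real N \<le> real m * real (t N) + real m + real d"
        by (metis of_nat_le_iff of_nat_mult, metis of_nat_add of_nat_le_iff of_nat_mult)
      moreover have "real d \<le> real m * real d"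
        using \<open>m > 0\<close> mult_right_mono[of 1 "real m" "real d"] by simp
      ultimately have "real N / real m \<le> real (t N) + 1 + real d" "real (t N) \<le> real N / real m"
        using \<open>m > 0\<close> by (simp_all add: field_simps)
      then show ?thesis by linarith
    qed
  qed
  have "(\<lambda>N. (\<Sum>s<t N. h s) / real (t N)) \<longlonglongrightarrow> (\<Sum>r<m. L r)"
    using filterlim_compose[OF mean_h[unfolded has_mean_def] t_lim] by simp
  from tendsto_mult[OF this ratio]
  have lim: "(\<lambda>N. (\<Sum>s<t N. h s) / real (t N) * (real (t N) / real N)) \<longlonglongrightarrow> (\<Sum>r<m. L r) / real m"
    by simp
  have eq: "(\<Sum>s<t N. h s) / real (t N) * (real (t N) / real N) = (\<Sum>s<t N. h s) / real N" for N
    by (cases "t N = 0") auto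
  show ?thesis unfolding has_mean_def
  proof (rule mean_bounded_error[OF lim[unfolded eq]])
    fix N
    have card_bound: "\<bar>\<Sum>n\<in>A. f n\<bar> \<le> real (card A)" for A
      using order_trans[OF sum_abs[of f A] sum_mono[of A "\<lambda>n. \<bar>f n\<bar>" "\<lambda>_. 1"]] bdd by simp
    show "\<bar>(\<Sum>n<N. f n) - (\<Sum>s<t N. h s)\<bar> \<le> real (d + m) + real d"
    proof (cases "N < d")
      case True
      then have "t N = 0" by (simp add: t_def)
      then show ?thesis using card_bound[of "{..<N}"] True by simp
    next
      case False
      define M where "M = d + m * t N"
      have "(N - d) = m * t N + (N - d) mod m" "(N - d) mod m < m"
        using \<open>m > 0\<close> by (auto simp: t_def)
      then have M: "M \<le> N" "N \<le> M + m" using False unfolding M_def by linarith+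
      have "(\<Sum>n<N. f n) = (\<Sum>n<M. f n) + (\<Sum>n\<in>{M..<N}. f n)"
        using M(1) by (metis atLeast0LessThan sum.atLeastLessThan_concat zero_le)
      also have "(\<Sum>n<M. f n) = (\<Sum>n<d. f n) + (\<Sum>s<t N. h s)"
        unfolding M_def h_def by (rule sum_progression)
      finally show ?thesis
        using card_bound[of "{..<d}"] card_bound[of "{M..<N}"] M by simp
    qed
  qed
qed

text \<open>
  Passing to a residue class loses the value of the density but keeps an upper bound, up to a
  factor which depends only on the modulus. This is all that the hypothesis \<open>bounded_visits\<close>
  below asks for. The bound \<open>K\<close> is positive so that the constant 4 can absorb all error terms.
\<close>

lemma sum_progression_le_mean:
  assumes "\<And>n. 0 \<le> f n" "has_mean f L" "L \<le> K" "K > 0" "m > 0"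
  shows "\<forall>\<^sub>F N in sequentially. (\<Sum>t<N. f (d + m * t)) \<le> 4 * real m * K * real N"
proof -
  have "\<forall>\<^sub>F M in sequentially. (\<Sum>n<M. f n) / real M < 2 * K"
    using assms by (auto simp: has_mean_def intro: order_tendstoD(2))
  then obtain M0 where M0: "\<And>M. M \<ge> M0 \<Longrightarrow> (\<Sum>n<M. f n) / real M < 2 * K"
    by (auto simp: eventually_sequentially)
  show ?thesis
  proof (rule eventually_sequentiallyI[of "M0 + d + 1"])
    fix N assume N: "M0 + d + 1 \<le> N"
    have "N \<le> m * N" "d \<le> m * N" using \<open>m > 0\<close> N by (auto intro: order_trans[of d N])
    then have big: "M0 \<le> d + m * N" "d + m * N > 0" "d + m * N \<le> 2 * (m * N)" using N by linarith+
    have "(\<Sum>t<N. f (d + m * t)) \<le> (\<Sum>t<N. \<Sum>r<m. f (d + m * t + r))"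
    proof (rule sum_mono)
      fix t
      show "f (d + m * t) \<le> (\<Sum>r<m. f (d + m * t + r))"
        using member_le_sum[of 0 "{..<m}" "\<lambda>r. f (d + m * t + r)"] assms by auto
    qed
    also have "\<dots> \<le> (\<Sum>n<d + m * N. f n)"
      unfolding sum_progression using assms(1) by (simp add: sum_nonneg)
    also have "\<dots> \<le> 2 * K * real (d + m * N)"
      using M0[OF big(1)] big(2) by (simp add: pos_divide_less_eq del: of_nat_add)
    also have "\<dots> \<le> 2 * K * real (2 * (m * N))"
      using big(3) \<open>K > 0\<close> by (intro mult_left_mono) (auto simp del: of_nat_add of_nat_mult)
    finally show "(\<Sum>t<N. f (d + m * t)) \<le> 4 * real m * K * real N" by (simp add: mult_ac)
  qed
qed

lemma sum_of_bool_lessThan: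
  "(\<Sum>n<N. of_bool (P n)) = real (card {n::nat. n < N \<and> P n})"
  by (subst sum_of_bool_eq) (simp_all add: Int_def)

lemma uniformly_distributed_mod1_iff_has_mean:
  "uniformly_distributed_mod1 u \<longleftrightarrow>
     (\<forall>a b. 0 \<le> a \<longrightarrow> a < b \<longrightarrow> b \<le> 1 \<longrightarrow>
        has_mean (\<lambda>n. of_bool (a \<le> frac (u n) \<and> frac (u n) < b)) (b - a))"
  by (simp add: uniformly_distributed_mod1_def has_mean_def sum_of_bool_lessThan)

section \<open>Digits as cells of the unit interval\<close>

lemma floor_mult_frac:
  "\<lfloor>real q * z\<rfloor> = int q * \<lfloor>z\<rfloor> + \<lfloor>real q * frac z\<rfloor>"
proof -
  have "real q * z = real q * frac z + of_int (int q * \<lfloor>z\<rfloor>)"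
    by (simp add: frac_def algebra_simps)
  then show ?thesis by (metis add.commute floor_add_int)
qed

lemma frac_mult_frac: "frac (real q * frac z) = frac (real q * z)"
  unfolding frac_def[of "real q * z"] frac_def[of "real q * frac z"] floor_mult_frac[of q z]
  by (simp add: frac_def algebra_simps)

lemma floor_mult_frac_bounds:
  assumes "q > 0"
  shows "0 \<le> \<lfloor>real q * frac z\<rfloor>" "\<lfloor>real q * frac z\<rfloor> < int q"
proof -
  show "0 \<le> \<lfloor>real q * frac z\<rfloor>" by simp
  have "real q * frac z < real q * 1"
    using assms frac_lt_1[of z] by (intro mult_strict_left_mono) auto
  then show "\<lfloor>real q * frac z\<rfloor> < int q" by (simp add: floor_less_iff)
qed

text \<open>
  The index of the interval \<open>[a / q, (a + 1) / q)\<close> that contains the fractional part of \<open>z\<close>.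
  For \<open>q = b ^ k\<close> it is the number whose base-\<open>b\<close> digits are the first \<open>k\<close> digits of \<open>frac z\<close>.
\<close>

definition cell :: "nat \<Rightarrow> real \<Rightarrow> nat" where
  "cell q z = nat \<lfloor>real q * frac z\<rfloor>"

lemma cell_less: "q > 0 \<Longrightarrow> cell q z < q"
  using floor_mult_frac_bounds[of q z] by (simp add: cell_def nat_less_iff)

lemma int_cell: "int (cell q z) = \<lfloor>real q * frac z\<rfloor>"
  by (simp add: cell_def)

lemma mult_frac_eq_cell: "real q * frac z = real (cell q z) + frac (real q * z)"
proof -
  have "real q * frac z = of_int \<lfloor>real q * frac z\<rfloor> + frac (real q * frac z)" by (simp add: frac_def)
  then show ?thesis by (simp add: frac_mult_frac flip: int_cell)
qed

text \<open>
  The first digits of \<open>z\<close> for the bases \<open>p\<close> and \<open>q\<close> in this order: the second digit of \<open>z\<close>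
  is the first digit of \<open>p * z\<close>. All relations between digits at different scales come from
  this identity.
\<close>

lemma cell_mult:
  "cell (p * q) z = q * cell p z + cell q (real p * z)"
proof -
  have "int (cell (p * q) z) = \<lfloor>real q * (real p * frac z)\<rfloor>"
    by (simp add: int_cell mult_ac)
  also have "\<dots> = int q * int (cell p z) + int (cell q (real p * z))"
    by (subst floor_mult_frac) (simp add: frac_mult_frac int_cell)
  finally show ?thesis by (metis of_nat_add of_nat_eq_iff of_nat_mult)
qed

lemma cell_eq_iff:
  "q > 0 \<Longrightarrow> cell q z = a \<longleftrightarrow> real a / real q \<le> frac z \<and> frac z < (real a + 1) / real q"
proof -
  assume "q > 0"
  have "cell q z = a \<longleftrightarrow> \<lfloor>real q * frac z\<rfloor> = int a"
    by (metis int_cell of_nat_eq_iff)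
  also have "\<dots> \<longleftrightarrow> real a \<le> real q * frac z \<and> real q * frac z < real a + 1"
    by (simp add: floor_eq_iff)
  also have "\<dots> \<longleftrightarrow> real a / real q \<le> frac z \<and> frac z < (real a + 1) / real q"
    using \<open>q > 0\<close> by (simp add: field_simps)
  finally show ?thesis .
qed

section \<open>Bounded visits imply uniform distribution\<close>

text \<open>
  The sum of \<open>f\<close> over the \<open>L\<close> lowest base-\<open>B\<close> digits of \<open>u\<close>. Through the cell \<open>u\<close> of a point, a
  sum over \<open>L\<close> steps of its orbit becomes a function on the finite set \<open>{..<B ^ L}\<close>.
\<close>

primrec digit_sum :: "(nat \<Rightarrow> real) \<Rightarrow> nat \<Rightarrow> nat \<Rightarrow> nat \<Rightarrow> real" where
  "digit_sum f B 0 u = 0"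
| "digit_sum f B (Suc L) u = digit_sum f B L (u div B) + f (u mod B)"

lemma digit_sum_cell:
  assumes "B > 0"
  shows "digit_sum f B L (cell (B ^ L) z) = (\<Sum>l<L. f (cell B (real (B ^ l) * z)))"
proof (induction L)
  case (Suc L)
  have c: "cell (B ^ Suc L) z = B * cell (B ^ L) z + cell B (real (B ^ L) * z)"
    using cell_mult[of "B ^ L" B z] by (simp add: mult.commute)
  have "cell (B ^ Suc L) z div B = cell (B ^ L) z"
    "cell (B ^ Suc L) z mod B = cell B (real (B ^ L) * z)"
    using cell_less[OF assms] assms by (simp_all add: c del: power_Suc)
  then show ?case using Suc by (simp del: power_Suc)
qed simp

lemma sum_lessThan_mult:
  fixes h :: "nat \<Rightarrow> real"
  shows "(\<Sum>u<M * B. h u) = (\<Sum>w<M. \<Sum>v<B. h (B * w + v))"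
  using sum_progression[of h 0 B M] by (simp add: mult.commute)

text \<open>
  The digits of a uniformly chosen \<open>u < B ^ L\<close> are independent and \<open>f\<close> has mean 0, so the
  variance of the digit sum is \<open>L\<close> times that of a single digit. In the induction, independence
  is the vanishing of the mixed term when the square is summed over the last digit.
\<close>

lemma sum_digit_sum_sq:
  assumes "B > 0" "(\<Sum>v<B. f v) = 0" "\<And>v. \<bar>f v\<bar> \<le> 1"
  shows "(\<Sum>u<B ^ L. (digit_sum f B L u)\<^sup>2) \<le> real L * real B ^ L"
proof (induction L)
  case (Suc L)
  have f2: "(\<Sum>v<B. (f v)\<^sup>2) \<le> real B"
  proof -
    have "(\<Sum>v<B. (f v)\<^sup>2) \<le> (\<Sum>v<B. 1)"
      using assms(3) by (intro sum_mono) (simp add: abs_square_le_1)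
    then show ?thesis by simp
  qed
  have "(\<Sum>u<B ^ Suc L. (digit_sum f B (Suc L) u)\<^sup>2)
      = (\<Sum>w<B ^ L. \<Sum>v<B. (digit_sum f B L w + f v)\<^sup>2)"
    using assms(1) by (simp only: power_Suc2 sum_lessThan_mult) simp
  also have "\<dots> = (\<Sum>w<B ^ L. real B * (digit_sum f B L w)\<^sup>2 + (\<Sum>v<B. (f v)\<^sup>2))"
  proof (rule sum.cong[OF refl])
    fix w
    have "(\<Sum>v<B. (digit_sum f B L w + f v)\<^sup>2)
        = (\<Sum>v<B. (digit_sum f B L w)\<^sup>2 + (f v)\<^sup>2 + 2 * digit_sum f B L w * f v)"
      by (simp add: power2_sum)
    then show "(\<Sum>v<B. (digit_sum f B L w + f v)\<^sup>2)
        = real B * (digit_sum f B L w)\<^sup>2 + (\<Sum>v<B. (f v)\<^sup>2)"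
      using assms(2) by (simp add: sum.distrib flip: sum_distrib_left)
  qed
  also have "\<dots> = real B * (\<Sum>w<B ^ L. (digit_sum f B L w)\<^sup>2) + real B ^ L * (\<Sum>v<B. (f v)\<^sup>2)"
    by (simp add: sum.distrib sum_distrib_left)
  also have "\<dots> \<le> real B * (real L * real B ^ L) + real B ^ L * real B"
    using Suc f2 by (intro add_mono mult_left_mono) auto
  finally show ?case by (simp add: algebra_simps)
qed simp

text \<open>
  The hypothesis of the Pyatetskii-Shapiro criterion: the orbit of \<open>y\<close> under multiplication by
  \<open>b\<close> visits each base-\<open>b\<close> cell at most \<open>C\<close> times as often as it should. The number of steps after
  which the bound holds may depend on the cell, while \<open>C\<close> may not.
\<close>

definition bounded_visits :: "nat \<Rightarrow> real \<Rightarrow> real \<Rightarrow> bool" where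
  "bounded_visits b y C \<longleftrightarrow> (\<forall>k>0. \<forall>a<b ^ k.
     \<forall>\<^sub>F N in sequentially.
       real (card {n. n < N \<and> cell (b ^ k) (real (b ^ n) * y) = a}) \<le> C / real (b ^ k) * real N)"

lemma sum_shift_error:
  fixes f :: "nat \<Rightarrow> real"
  assumes "\<And>n. \<bar>f n\<bar> \<le> 1"
  shows "\<bar>(\<Sum>n<N. f (n + s)) - (\<Sum>n<N. f n)\<bar> \<le> 2 * real s"
proof (induction s)
  case (Suc s)
  have "(\<Sum>n<N. f (n + Suc s)) = (\<Sum>n<N. f (n + s)) + f (N + s) - f s"
    by (induction N) simp_all
  with Suc assms[of "N + s"] assms[of s] show ?case by simp
qed simp

text \<open>
  Shifting the summation index changes a sum of bounded terms by a bounded amount, so the sum of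
  \<open>f\<close> over the digits along the orbit may be replaced by its average over \<open>L\<close> shifts, which is
  the sum over \<open>n\<close> of digit sums divided by \<open>L\<close>. The visits bound compares the mean square of the
  digit sums along the orbit with \<open>C\<close> times the mean square over all cells, which is at most \<open>L\<close>.
  Hence a typical digit sum is of order \<open>sqrt (C * L)\<close>, small compared with \<open>L\<close>.
  The parameter \<open>e\<close> belongs to the inequality between arithmetic and geometric means that
  passes from squares to absolute values.
\<close>

lemma hot_spot_sum_bound:
  fixes b k L :: nat
  assumes b: "b \<ge> 2" and k: "k > 0" and L: "L > 0" and "C > 0" and bv: "bounded_visits b y C"
    and f0: "(\<Sum>v<b ^ k. f v) = 0" and f1: "\<And>v. \<bar>f v\<bar> \<le> (1::real)" and "e > 0"
  shows "\<forall>\<^sub>F N in sequentially.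
    \<bar>\<Sum>n<N. f (cell (b ^ k) (real (b ^ n) * y))\<bar> \<le> (e + C / (e * real L)) / 2 * real N + 2 * real (k * L)"
proof -
  define B where "B = b ^ k"
  define \<phi> where "\<phi> n = f (cell B (real (b ^ n) * y))" for n
  define w where "w n = cell (B ^ L) (real (b ^ n) * y)" for n
  have B: "B > 0" using b by (simp add: B_def)
  have g: "digit_sum f B L (w n) = (\<Sum>l<L. \<phi> (n + k * l))" for n
    unfolding w_def digit_sum_cell[OF B] \<phi>_def
    by (simp add: B_def power_add mult_ac flip: power_mult)
  have w_less: "w n < B ^ L" for n unfolding w_def using B by (intro cell_less) auto
  have "\<forall>\<^sub>F N in sequentially. \<forall>u\<in>{..<B ^ L}.
      real (card {n. n < N \<and> w n = u}) \<le> C / real (B ^ L) * real N"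
    using bv k L unfolding bounded_visits_def w_def B_def
    by (intro eventually_ball_finite) (auto simp flip: power_mult)
  then show ?thesis
  proof eventually_elim
    fix N assume visits: "\<forall>u\<in>{..<B ^ L}. real (card {n. n < N \<and> w n = u}) \<le> C / real (B ^ L) * real N"
    define S where "S = (\<Sum>n<N. \<phi> n)"
    have sq: "(\<Sum>n<N. (digit_sum f B L (w n))\<^sup>2) \<le> C * real L * real N"
    proof -
      have "(\<Sum>n<N. (digit_sum f B L (w n))\<^sup>2)
          = (\<Sum>u<B ^ L. \<Sum>n\<in>{n\<in>{..<N}. w n = u}. (digit_sum f B L (w n))\<^sup>2)"
        using w_less by (intro sum.group[symmetric]) auto
      also have "\<dots> = (\<Sum>u<B ^ L. (digit_sum f B L u)\<^sup>2 * real (card {n. n < N \<and> w n = u}))"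
        by (intro sum.cong) (simp_all add: mult.commute)
      also have "\<dots> \<le> (\<Sum>u<B ^ L. (digit_sum f B L u)\<^sup>2 * (C / real (B ^ L) * real N))"
        using visits by (intro sum_mono mult_left_mono) auto
      also have "\<dots> = (\<Sum>u<B ^ L. (digit_sum f B L u)\<^sup>2) * (C / real (B ^ L) * real N)"
        by (rule sum_distrib_right[symmetric])
      also have "\<dots> \<le> (real L * real B ^ L) * (C / real (B ^ L) * real N)"
        using sum_digit_sum_sq[OF B] f0 f1 \<open>C > 0\<close> by (intro mult_right_mono) (auto simp: B_def)
      also have "\<dots> = C * real L * real N" using B by simp
      finally show ?thesis .
    qed
    have el: "e * real L > 0" using \<open>e > 0\<close> L by simp
    have amgm: "\<bar>v\<bar> \<le> (e * real L + v\<^sup>2 / (e * real L)) / 2" for v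
    proof -
      have "0 \<le> (\<bar>v\<bar> - e * real L)\<^sup>2" by simp
      then have "2 * \<bar>v\<bar> * (e * real L) \<le> (e * real L)\<^sup>2 + v\<^sup>2" by (simp add: power2_diff algebra_simps)
      then have "2 * \<bar>v\<bar> \<le> ((e * real L)\<^sup>2 + v\<^sup>2) / (e * real L)" using el by (simp add: pos_le_divide_eq)
      also have "\<dots> = e * real L + v\<^sup>2 / (e * real L)"
        using el by (simp add: add_divide_distrib power2_eq_square)
      finally show ?thesis by simp
    qed
    have "\<bar>\<Sum>n<N. digit_sum f B L (w n)\<bar>
        \<le> (\<Sum>n<N. (e * real L + (digit_sum f B L (w n))\<^sup>2 / (e * real L)) / 2)"
      by (rule order_trans[OF sum_abs]) (intro sum_mono amgm)
    also have "\<dots> = (e * real L * real N + (\<Sum>n<N. (digit_sum f B L (w n))\<^sup>2) / (e * real L)) / 2"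
      by (simp add: sum.distrib flip: sum_divide_distrib)
    also have "\<dots> \<le> (e * real L * real N + (C * real L * real N) / (e * real L)) / 2"
      using sq el by (intro divide_right_mono add_left_mono) auto
    finally have G: "\<bar>\<Sum>n<N. digit_sum f B L (w n)\<bar>
        \<le> (e * real L * real N + (C * real L * real N) / (e * real L)) / 2" .
    have shift: "\<bar>(\<Sum>n<N. \<phi> (n + k * l)) - S\<bar> \<le> 2 * real (k * l)" for l
      unfolding S_def by (rule sum_shift_error) (simp add: \<phi>_def f1)
    have "\<bar>(\<Sum>n<N. digit_sum f B L (w n)) - real L * S\<bar> = \<bar>\<Sum>l<L. (\<Sum>n<N. \<phi> (n + k * l)) - S\<bar>"
      unfolding g by (subst sum.swap) (simp add: sum_subtractf)
    also have "\<dots> \<le> (\<Sum>l<L. 2 * real (k * l))"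
      by (intro order_trans[OF sum_abs] sum_mono shift)
    also have "\<dots> \<le> (\<Sum>l<L. 2 * real (k * L))"
      by (intro sum_mono) (simp add: mult_left_mono)
    finally have D: "\<bar>(\<Sum>n<N. digit_sum f B L (w n)) - real L * S\<bar> \<le> real L * (2 * real (k * L))" by simp
    have "real L * \<bar>S\<bar> = \<bar>real L * S\<bar>" by (simp add: abs_mult)
    also have "\<dots> \<le> (e * real L * real N + (C * real L * real N) / (e * real L)) / 2
        + real L * (2 * real (k * L))" using G D by linarith
    also have "\<dots> = real L * ((e + C / (e * real L)) / 2 * real N + 2 * real (k * L))"
      using el L by (simp add: field_simps)
    finally show "\<bar>\<Sum>n<N. f (cell (b ^ k) (real (b ^ n) * y))\<bar>
        \<le> (e + C / (e * real L)) / 2 * real N + 2 * real (k * L)"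
      using L by (simp add: S_def \<phi>_def B_def)
  qed
qed

text \<open>
  The bound above for the base \<open>b ^ k\<close> and the centred indicator function of the digit \<open>a\<close>:
  since \<open>L\<close> is arbitrary, its sum along the orbit is \<open>o(N)\<close>.
\<close>

lemma has_mean_cell:
  assumes b: "b \<ge> 2" and k: "k > 0" and "C > 0" and bv: "bounded_visits b y C" and a: "a < b ^ k"
  shows "has_mean (\<lambda>n. of_bool (cell (b ^ k) (real (b ^ n) * y) = a)) (1 / real (b ^ k))"
proof -
  define f where "f v = of_bool (v = a) - 1 / real (b ^ k)" for v
  define S where "S N = (\<Sum>n<N. f (cell (b ^ k) (real (b ^ n) * y)))" for N
  have f0: "(\<Sum>v<b ^ k. f v) = 0" using a b by (simp add: f_def sum_subtractf of_bool_def)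
  have "1 / real (b ^ k) \<le> 1" "0 \<le> 1 / real (b ^ k)" using b by (simp_all add: one_le_power)
  then have f1: "\<bar>f v\<bar> \<le> 1" for v unfolding f_def by (cases "v = a") auto
  have "(\<lambda>N. S N / real N) \<longlonglongrightarrow> 0"
  proof (rule LIMSEQ_I)
    fix e :: real assume "e > 0"
    define d where "d = e / 2"
    have "d > 0" using \<open>e > 0\<close> by (simp add: d_def)
    \<comment> \<open>With \<open>C / d\<^sup>2 \<le> L\<close> the linear term is at most \<open>d * N\<close>; the constant term
       is below \<open>d * N\<close> for large \<open>N\<close>.\<close>
    define L where "L = nat \<lceil>C / d\<^sup>2\<rceil> + 1"
    have "L > 0" by (simp add: L_def)
    have "C / d\<^sup>2 \<le> real L" unfolding L_def by linarith
    then have CL: "C / (d * real L) \<le> d"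
      using \<open>d > 0\<close> \<open>L > 0\<close> by (simp add: field_simps power2_eq_square)
    obtain N0 where N0: "\<And>N. N \<ge> N0 \<Longrightarrow>
        \<bar>S N\<bar> \<le> (d + C / (d * real L)) / 2 * real N + 2 * real (k * L)"
      using hot_spot_sum_bound[OF b k \<open>L > 0\<close> \<open>C > 0\<close> bv f0 f1 \<open>d > 0\<close>]
      unfolding S_def eventually_sequentially by blast
    obtain N1 :: nat where N1: "2 * real (k * L) / d < real N1" using reals_Archimedean2 by blast
    have "norm (S N / real N - 0) < e" if N: "N \<ge> N0 + N1 + 1" for N
    proof -
      have "real N1 \<le> real N" using N by simp
      with N1 have "2 * real (k * L) / d < real N" by linarith
      then have "2 * real (k * L) < d * real N"
        using \<open>d > 0\<close> by (simp only: pos_divide_less_eq mult.commute)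
      moreover have "(d + C / (d * real L)) / 2 * real N \<le> d * real N"
        using CL by (intro mult_right_mono) auto
      ultimately have "\<bar>S N\<bar> < d * real N + d * real N" using N0[of N] N by linarith
      then have "\<bar>S N\<bar> < e * real N" by (simp add: d_def)
      then show ?thesis using N by (simp add: abs_div pos_divide_less_eq)
    qed
    then show "\<exists>N0. \<forall>N\<ge>N0. norm (S N / real N - 0) < e" by blast
  qed
  then have "has_mean (\<lambda>n. f (cell (b ^ k) (real (b ^ n) * y))) 0" by (simp add: has_mean_def S_def)
  from has_mean_diff[OF this has_mean_const[of "- 1 / real (b ^ k)"]] show ?thesis by (simp add: f_def)
qed

text \<open>
  Approximation of \<open>[0, \<beta>)\<close> from inside and outside by unions of cells of the same level, which
  differ in one cell.
\<close>

lemma has_mean_frac_less: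
  assumes b: "b \<ge> 2" and "C > 0" and bv: "bounded_visits b y C" and "0 \<le> \<beta>" "\<beta> \<le> 1"
  shows "has_mean (\<lambda>n. of_bool (frac (real (b ^ n) * y) < \<beta>)) \<beta>"
proof (cases "\<beta> = 1")
  case True
  then show ?thesis using has_mean_const[of 1] by (simp add: frac_lt_1)
next
  case False
  show ?thesis
  proof (rule has_mean_squeeze)
    fix e :: real assume "e > 0"
    obtain k where k: "1 / e < real (b ^ k)" "k > 0"
    proof -
      obtain k where "1 / e < real b ^ k" using real_arch_pow[of "real b" "1 / e"] b by auto
      also have "\<dots> \<le> real b ^ Suc k" using b by (intro power_increasing) auto
      finally show ?thesis using that[of "Suc k"] by simp
    qed
    define B where "B = b ^ k"
    define z where "z n = real (b ^ n) * y" for n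
    have B: "B > 0" using b by (simp add: B_def)
    have Be: "1 / real B < e" using k(1) B \<open>e > 0\<close> by (simp add: B_def field_simps)
    define j where "j = nat \<lfloor>\<beta> * real B\<rfloor>"
    have j: "real j \<le> \<beta> * real B" "\<beta> * real B < real j + 1"
      using \<open>0 \<le> \<beta>\<close> unfolding j_def by (auto simp: of_nat_nat)
    have "\<beta> * real B < 1 * real B" using False \<open>\<beta> \<le> 1\<close> B by (intro mult_strict_right_mono) auto
    then have jB: "j < B" using j(1) by simp
    have mean: "has_mean (\<lambda>n. of_bool (cell B (z n) < i)) (real i / real B)" if "i \<le> B" for i
    proof -
      have "has_mean (\<lambda>n. \<Sum>a<i. of_bool (cell B (z n) = a)) (\<Sum>a<i. 1 / real B)"
        unfolding B_def z_def using that
        by (intro has_mean_sum has_mean_cell[OF b k(2) \<open>C > 0\<close> bv]) (auto simp: B_def)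
      moreover have "(\<Sum>a<i. of_bool (cell B (z n) = a)) = (of_bool (cell B (z n) < i) :: real)" for n
        by (simp add: of_bool_def sum.delta)
      ultimately show ?thesis by simp
    qed
    have cell: "real (cell B (z n)) \<le> real B * frac (z n)" "real B * frac (z n) < real (cell B (z n)) + 1" for n
      unfolding cell_def by (auto simp: of_nat_nat)
    show "\<exists>g l h u. has_mean g l \<and> has_mean h u \<and> \<beta> - e < l \<and> u < \<beta> + e \<and>
        (\<forall>n. g n \<le> of_bool (frac (real (b ^ n) * y) < \<beta>) \<and> of_bool (frac (real (b ^ n) * y) < \<beta>) \<le> h n)"
    proof (intro exI conjI allI)
      show "has_mean (\<lambda>n. of_bool (cell B (z n) < j)) (real j / real B)"
        "has_mean (\<lambda>n. of_bool (cell B (z n) < Suc j)) (real (Suc j) / real B)"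
        using mean[of j] mean[of "Suc j"] jB by (simp_all del: of_nat_Suc)
      have "\<beta> < (real j + 1) / real B" "real j / real B \<le> \<beta>"
        using j B by (simp_all add: field_simps)
      then show "\<beta> - e < real j / real B" "real (Suc j) / real B < \<beta> + e"
        using Be by (simp_all add: add_divide_distrib)
      fix n
      have "frac (z n) < \<beta>" if "cell B (z n) < j"
      proof -
        have "real (cell B (z n)) + 1 \<le> real j" using that by linarith
        then have "real B * frac (z n) < real B * \<beta>" using cell(2)[of n] j(1) by (simp add: mult.commute)
        then show ?thesis using B by simp
      qed
      then show "of_bool (cell B (z n) < j) \<le> (of_bool (frac (real (b ^ n) * y) < \<beta>) :: real)"
        by (auto simp: z_def)
      have "cell B (z n) < Suc j" if "frac (z n) < \<beta>"
      proof -
        have "real B * frac (z n) < real B * \<beta>" using that B by simp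
        then have "real (cell B (z n)) < real j + 1" using cell(1)[of n] j(2) by (simp add: mult.commute)
        then show ?thesis by linarith
      qed
      then show "of_bool (frac (real (b ^ n) * y) < \<beta>) \<le> (of_bool (cell B (z n) < Suc j) :: real)"
        by (auto simp: z_def)
    qed
  qed
qed

text \<open>
  The Pyatetskii-Shapiro criterion. It is the reason why all notions of normality considered here
  coincide: each of them gives an upper bound for visit frequencies with some loss by a constant
  factor, and the loss costs nothing.
\<close>

theorem uniformly_distributed_if_bounded_visits:
  assumes "b \<ge> 2" "C > 0" "bounded_visits b y C"
  shows "uniformly_distributed_mod1 (\<lambda>n. real (b ^ n) * y)"
  unfolding uniformly_distributed_mod1_iff_has_mean
proof (intro allI impI)
  fix \<alpha> \<beta> :: real assume \<alpha>\<beta>: "0 \<le> \<alpha>" "\<alpha> < \<beta>" "\<beta> \<le> 1"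
  have "has_mean (\<lambda>n. of_bool (frac (real (b ^ n) * y) < \<beta>) - of_bool (frac (real (b ^ n) * y) < \<alpha>)) (\<beta> - \<alpha>)"
    using assms \<alpha>\<beta> by (intro has_mean_diff has_mean_frac_less) auto
  moreover have "of_bool (z < \<beta>) - of_bool (z < \<alpha>) = (of_bool (\<alpha> \<le> z \<and> z < \<beta>) :: real)" for z
    using \<alpha>\<beta> by auto
  ultimately show "has_mean (\<lambda>n. of_bool (\<alpha> \<le> frac (real (b ^ n) * y) \<and> frac (real (b ^ n) * y) < \<beta>)) (\<beta> - \<alpha>)"
    by simp
qed

lemma has_mean_cell_if_uniformly_distributed:
  assumes u: "uniformly_distributed_mod1 u" and "a < q"
  shows "has_mean (\<lambda>n. of_bool (cell q (u n) = a)) (1 / real q)"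
proof -
  have "real a + 1 \<le> real q" "q > 0" using assms(2) by linarith+
  then have "has_mean (\<lambda>n. of_bool (real a / real q \<le> frac (u n) \<and> frac (u n) < (real a + 1) / real q))
     ((real a + 1) / real q - real a / real q)"
    by (intro u[unfolded uniformly_distributed_mod1_iff_has_mean, rule_format])
       (auto simp: divide_strict_right_mono)
  then show ?thesis using \<open>q > 0\<close> by (simp add: cell_eq_iff add_divide_distrib)
qed

section \<open>Integer multiples\<close>

lemma cell_nat_mult:
  assumes "p > 0"
  shows "\<exists>e<p. cell q (real p * z) = (p * cell q z + e) mod q"
proof (cases "q = 0")
  case True
  then show ?thesis using assms by (intro exI[of _ 0]) (simp add: cell_def)
next
  case False
  \<comment> \<open>The cell of \<open>z\<close> for the modulus \<open>p * q\<close> is split with the factors in either order.\<close>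
  define e where "e = cell p (real q * z)"
  have "q * cell p z + cell q (real p * z) = p * cell q z + e"
    using cell_mult[of p q z] cell_mult[of q p z] by (simp add: mult.commute e_def)
  then have "(p * cell q z + e) mod q = (q * cell p z + cell q (real p * z)) mod q" by simp
  also have "\<dots> = cell q (real p * z)" using cell_less[of q] False by simp
  finally show ?thesis using cell_less[OF assms, of "real q * z"]
    by (intro exI[of _ e]) (simp add: e_def)
qed

text \<open>
  If \<open>y\<close> lies in a given cell then \<open>p * y\<close> lies in one of \<open>p\<close> cells of the same level, so an excess of
  visits by the orbit of \<open>y\<close> would be one by the orbit of \<open>p * y\<close>. With the criterion above this
  allows division by \<open>p\<close>, and so the removal of a finite initial part of a basic sequence.
\<close>

lemma bounded_visits_of_multiple:
  assumes "p > 0" "b > 0" and bv: "bounded_visits b (real p * y) C"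
  shows "bounded_visits b y (real p * C)"
  unfolding bounded_visits_def
proof (intro allI impI)
  fix k a :: nat assume k: "k > 0"
  define q where "q = b ^ k"
  have q: "q > 0" using assms by (simp add: q_def)
  define V where "V N u = {n. n < N \<and> cell q (real (b ^ n) * (real p * y)) = u}" for N u
  have "\<forall>\<^sub>F N in sequentially. \<forall>e\<in>{..<p}. real (card (V N ((p * a + e) mod q))) \<le> C / real q * real N"
    using bv k q unfolding V_def bounded_visits_def q_def
    by (intro eventually_ball_finite) auto
  then show "\<forall>\<^sub>F N in sequentially. real (card {n. n < N \<and> cell (b ^ k) (real (b ^ n) * y) = a})
      \<le> real p * C / real (b ^ k) * real N"
  proof eventually_elim
    fix N assume *: "\<forall>e\<in>{..<p}. real (card (V N ((p * a + e) mod q))) \<le> C / real q * real N"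
    have "{n. n < N \<and> cell q (real (b ^ n) * y) = a} \<subseteq> (\<Union>e<p. V N ((p * a + e) mod q))"
    proof
      fix n assume n: "n \<in> {n. n < N \<and> cell q (real (b ^ n) * y) = a}"
      with cell_nat_mult[OF \<open>p > 0\<close>, of q "real (b ^ n) * y"] obtain e where
        "e < p" "cell q (real p * (real (b ^ n) * y)) = (p * a + e) mod q" by auto
      then have "cell q (real (b ^ n) * (real p * y)) = (p * a + e) mod q"
        by (simp only: mult.left_commute[of "real p"])
      with \<open>e < p\<close> show "n \<in> (\<Union>e<p. V N ((p * a + e) mod q))"
        using n unfolding V_def by auto
    qed
    then have "card {n. n < N \<and> cell q (real (b ^ n) * y) = a} \<le> card (\<Union>e<p. V N ((p * a + e) mod q))"
      by (intro card_mono) (auto simp: V_def)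
    also have "\<dots> \<le> (\<Sum>e<p. card (V N ((p * a + e) mod q)))" by (rule card_UN_le) simp
    finally have "real (card {n. n < N \<and> cell q (real (b ^ n) * y) = a})
        \<le> real (\<Sum>e<p. card (V N ((p * a + e) mod q)))" by (simp only: of_nat_le_iff)
    also have "\<dots> = (\<Sum>e<p. real (card (V N ((p * a + e) mod q))))" by (rule of_nat_sum)
    also have "\<dots> \<le> (\<Sum>e<p. C / real q * real N)" using * by (intro sum_mono) auto
    finally show "real (card {n. n < N \<and> cell (b ^ k) (real (b ^ n) * y) = a})
        \<le> real p * C / real (b ^ k) * real N" by (simp add: q_def)
  qed
qed

text \<open>
  The preimage of an interval under multiplication by \<open>h\<close> modulo 1 consists of \<open>h\<close> intervals of
  \<open>1 / h\<close> times its length.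
\<close>

lemma uniformly_distributed_nat_mult:
  assumes "h > 0" and u: "uniformly_distributed_mod1 u"
  shows "uniformly_distributed_mod1 (\<lambda>n. real h * u n)"
  unfolding uniformly_distributed_mod1_iff_has_mean
proof (intro allI impI)
  fix \<alpha> \<beta> :: real assume \<alpha>\<beta>: "0 \<le> \<alpha>" "\<alpha> < \<beta>" "\<beta> \<le> 1"
  have "has_mean (\<lambda>n. of_bool ((real i + \<alpha>) / real h \<le> frac (u n) \<and> frac (u n) < (real i + \<beta>) / real h))
      ((\<beta> - \<alpha>) / real h)" if "i < h" for i
  proof -
    have "real i + 1 \<le> real h" using that by linarith
    then have "0 \<le> (real i + \<alpha>) / real h" "(real i + \<alpha>) / real h < (real i + \<beta>) / real h"
      "(real i + \<beta>) / real h \<le> 1"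
      using \<alpha>\<beta> \<open>h > 0\<close> by (auto simp: divide_strict_right_mono)
    moreover have "(real i + \<beta>) / real h - (real i + \<alpha>) / real h = (\<beta> - \<alpha>) / real h"
      by (simp flip: diff_divide_distrib)
    ultimately show ?thesis
      using u[unfolded uniformly_distributed_mod1_iff_has_mean, rule_format,
          of "(real i + \<alpha>) / real h" "(real i + \<beta>) / real h"] by simp
  qed
  then have "has_mean (\<lambda>n. \<Sum>i<h. of_bool ((real i + \<alpha>) / real h \<le> frac (u n) \<and> frac (u n) < (real i + \<beta>) / real h))
      (\<Sum>i<h. (\<beta> - \<alpha>) / real h)"
    by (intro has_mean_sum) auto
  moreover have "(\<Sum>i<h. of_bool ((real i + \<alpha>) / real h \<le> frac z \<and> frac z < (real i + \<beta>) / real h))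
      = (of_bool (\<alpha> \<le> frac (real h * z) \<and> frac (real h * z) < \<beta>) :: real)" for z
  proof -
    define c where "c = cell h z"
    have c: "c < h" using cell_less[OF \<open>h > 0\<close>] by (simp add: c_def)
    have hz: "real h * frac z = real c + frac (real h * z)"
      unfolding c_def by (rule mult_frac_eq_cell)
    have "(real i + \<alpha>) / real h \<le> frac z \<and> frac z < (real i + \<beta>) / real h \<longleftrightarrow>
        i = c \<and> \<alpha> \<le> frac (real h * z) \<and> frac (real h * z) < \<beta>" for i
    proof -
      have "(real i + \<alpha>) / real h \<le> frac z \<and> frac z < (real i + \<beta>) / real h \<longleftrightarrow>
          real i + \<alpha> \<le> real h * frac z \<and> real h * frac z < real i + \<beta>"
        using \<open>h > 0\<close> by (simp add: field_simps)
      also have "\<dots> \<longleftrightarrow> i = c \<and> \<alpha> \<le> frac (real h * z) \<and> frac (real h * z) < \<beta>"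
        unfolding hz using \<alpha>\<beta> frac_ge_0[of "real h * z"] frac_lt_1[of "real h * z"]
        by (cases i c rule: linorder_cases) linarith+
      finally show ?thesis .
    qed
    then have "(\<Sum>i<h. of_bool ((real i + \<alpha>) / real h \<le> frac z \<and> frac z < (real i + \<beta>) / real h))
      = (\<Sum>i<h. if i = c then of_bool (\<alpha> \<le> frac (real h * z) \<and> frac (real h * z) < \<beta>) else (0::real))"
      by (intro sum.cong) auto
    then show ?thesis using c by simp
  qed
  ultimately show "has_mean (\<lambda>n. of_bool (\<alpha> \<le> frac (real h * u n) \<and> frac (real h * u n) < \<beta>)) (\<beta> - \<alpha>)"
    using \<open>h > 0\<close> by simp
qed

section \<open>Digits and blocks of a Cantor series\<close>

text \<open>
  The digits are read off the orbit in the same way as base-\<open>g\<close> digits: the difference between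
  \<open>frac x\<close> and the partial sums is \<open>frac (P n * x) / P n\<close>, where \<open>P n\<close> is the product of the
  first \<open>n\<close> bases. Uniqueness of the expansion does the rest.
\<close>

lemma cantor_digit_Suc:
  assumes Q: "basic_sequence Q"
  shows "cantor_digit Q x (Suc n) = int (cell (Q (Suc n)) (real (\<Prod>i=1..n. Q i) * x))"
proof -
  define P where "P n = real (\<Prod>i=1..n. Q i)" for n
  define F where "F n = (if n = 0 then \<lfloor>x\<rfloor> else int (cell (Q n) (P (n - 1) * x)))" for n
  have FS: "F (Suc n) = int (cell (Q (Suc n)) (P n * x))" for n by (simp add: F_def)
  have Q2: "Q (Suc n) \<ge> 2" for n using Q by (auto simp: basic_sequence_def)
  have PS: "P (Suc n) = real (Q (Suc n)) * P n" for n by (simp add: P_def mult.commute)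
  have P_pow: "2 ^ n \<le> P n" for n
  proof (induction n)
    case (Suc n)
    then show ?case unfolding PS power_Suc using Q2[of n] by (intro mult_mono) auto
  qed (simp add: P_def)
  have P_pos: "0 < P n" for n using P_pow[of n] by (rule less_le_trans[rotated]) simp
  have step: "real (Q (Suc n)) * frac (P n * x) = of_int (F (Suc n)) + frac (P (Suc n) * x)" for n
    using mult_frac_eq_cell[of "Q (Suc n)" "P n * x"] by (simp add: FS PS mult.assoc)
  have part: "(\<Sum>k<n. of_int (F (Suc k)) / P (Suc k)) = frac x - frac (P n * x) / P n" for n
  proof (induction n)
    case (Suc n)
    have "of_int (F (Suc n)) / P (Suc n) = frac (P n * x) / P n - frac (P (Suc n) * x) / P (Suc n)"
      using step[of n] P_pos[of n] Q2[of n] by (simp add: PS field_simps)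
    with Suc show ?case by simp
  qed (simp add: P_def)
  have "is_cantor_expansion Q x F"
    unfolding is_cantor_expansion_def
  proof (intro conjI allI impI)
    show "F 0 = \<lfloor>x\<rfloor>" by (simp add: F_def)
  next
    fix n :: nat assume "1 \<le> n"
    then obtain k where "n = Suc k" by (cases n) auto
    then show "0 \<le> F n" "F n \<le> int (Q n) - 1"
      using cell_less[of "Q (Suc k)" "P k * x"] Q2[of k] by (simp_all add: FS)
  next
    \<comment> \<open>A tail of maximal digits would multiply the positive gap \<open>1 - frac (P n * x)\<close>
       by at least 2 at every step.\<close>
    show "infinite {n. 1 \<le> n \<and> F n \<noteq> int (Q n) - 1}"
    proof
      assume "finite {n. 1 \<le> n \<and> F n \<noteq> int (Q n) - 1}"
      then obtain N where N: "\<forall>n\<in>{n. 1 \<le> n \<and> F n \<noteq> int (Q n) - 1}. n \<le> N"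
        using finite_nat_set_iff_bounded_le by blast
      define r where "r n = 1 - frac (P n * x)" for n
      have grow: "2 ^ k * r N \<le> r (N + k)" for k
      proof (induction k)
        case (Suc k)
        have "F (Suc (N + k)) = int (Q (Suc (N + k))) - 1" using N by force
        then have "real_of_int (F (Suc (N + k))) = real (Q (Suc (N + k))) - 1" by simp
        then have "r (Suc (N + k)) = real (Q (Suc (N + k))) * r (N + k)"
          using step[of "N + k"] by (simp add: r_def right_diff_distrib)
        moreover have "2 * r (N + k) \<le> real (Q (Suc (N + k))) * r (N + k)"
          using Q2[of "N + k"] frac_lt_1[of "P (N + k) * x"]
          by (intro mult_right_mono) (auto simp: r_def)
        ultimately show ?case using Suc by simp
      qed simp
      have rN: "0 < r N" by (simp add: r_def frac_lt_1)
      obtain k where "1 / r N < 2 ^ k" using real_arch_pow[of 2 "1 / r N"] by auto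
      then have "1 < 2 ^ k * r N" using rN by (simp add: field_simps)
      moreover have "r (N + k) \<le> 1" by (simp add: r_def)
      ultimately show False using grow[of k] by linarith
    qed
  next
    have "(\<lambda>n. frac (P n * x) / P n) \<longlonglongrightarrow> 0"
    proof (rule Lim_null_comparison)
      have "norm (frac (P n * x) / P n) \<le> (1 / 2) ^ n" for n
      proof -
        have "frac (P n * x) / P n \<le> 1 / 2 ^ n"
          using P_pow[of n] P_pos[of n] frac_lt_1[of "P n * x"] by (intro frac_le) auto
        then show ?thesis using P_pos[of n] by (simp add: power_divide)
      qed
      then show "\<forall>\<^sub>F n in sequentially. norm (frac (P n * x) / P n) \<le> (1 / 2) ^ n" by simp
      show "(\<lambda>n. (1 / 2) ^ n :: real) \<longlonglongrightarrow> 0" by (rule LIMSEQ_realpow_zero) auto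
    qed
    then have "(\<lambda>n. frac x - frac (P n * x) / P n) \<longlonglongrightarrow> frac x - 0" by (intro tendsto_diff tendsto_const)
    then have "(\<lambda>n. of_int (F (Suc n)) / P (Suc n)) sums (x - of_int (F 0))"
      unfolding sums_def part by (simp add: F_def frac_def)
    then show "(\<lambda>n. of_int (F (Suc n)) / real (\<Prod>i = 1..Suc n. Q i)) sums (x - of_int (F 0))"
      by (simp only: P_def)
  qed
  then have "cantor_digit Q x = F"
    unfolding cantor_digit_def by (rule the1_equality[OF cantor_expansion_unique[OF Q]])
  then show ?thesis by (simp add: FS P_def)
qed

text \<open>
  The number with digits \<open>e 0, e 1, \<dots>\<close> (the most significant one first) in the mixed radix
  system with bases \<open>q 0, q 1, \<dots>\<close>, in Horner form.
\<close>

primrec mixed_radix_value :: "(nat \<Rightarrow> nat) \<Rightarrow> (nat \<Rightarrow> nat) \<Rightarrow> nat \<Rightarrow> nat" where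
  "mixed_radix_value q e 0 = 0"
| "mixed_radix_value q e (Suc K) = q K * mixed_radix_value q e K + e K"

lemma mixed_radix_value_less:
  "(\<And>i. i < K \<Longrightarrow> e i < q i) \<Longrightarrow> mixed_radix_value q e K < (\<Prod>i<K. q i)"
proof (induction K)
  case (Suc K)
  have "Suc (mixed_radix_value q e K) \<le> (\<Prod>i<K. q i)" using Suc by (simp add: Suc_leI)
  then have "q K * Suc (mixed_radix_value q e K) \<le> q K * (\<Prod>i<K. q i)" by (rule mult_le_mono2)
  moreover have "e K < q K" using Suc.prems by simp
  ultimately show ?case by (simp add: mult.commute)
qed simp

lemma mixed_radix_value_surj:
  "v < (\<Prod>i<K. q i) \<Longrightarrow>
     \<exists>B. length B = K \<and> (\<forall>i<K. B ! i < q i) \<and> mixed_radix_value q ((!) B) K = v"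
proof (induction K arbitrary: v)
  case (Suc K)
  have "v div q K < (\<Prod>i<K. q i)" using Suc.prems by (simp add: less_mult_imp_div_less)
  then obtain B where B: "length B = K" "\<forall>i<K. B ! i < q i" "mixed_radix_value q ((!) B) K = v div q K"
    using Suc.IH by blast
  have "q K > 0" using Suc.prems by (cases "q K") auto
  have cong: "mixed_radix_value q ((!) (B @ [v mod q K])) j = mixed_radix_value q ((!) B) j" if "j \<le> K" for j
    using that B(1) by (induction j) (simp_all add: nth_append)
  have "(B @ [v mod q K]) ! K = v mod q K" using B(1) by (simp add: nth_append)
  then have "mixed_radix_value q ((!) (B @ [v mod q K])) (Suc K) = v"
    using cong[of K] B(3) by simp
  moreover have "\<forall>i<Suc K. (B @ [v mod q K]) ! i < q i"
    using B(1,2) \<open>q K > 0\<close> by (auto simp: nth_append less_Suc_eq)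
  ultimately show ?case using B(1) by (intro exI[of _ "B @ [v mod q K]"]) simp
qed simp

lemma cell_eq_mixed_radix_value_iff:
  assumes "\<And>i. i < K \<Longrightarrow> e i < q i"
  shows "(\<forall>i<K. cell (q i) (real (\<Prod>l<i. q l) * z) = e i)
    \<longleftrightarrow> cell (\<Prod>i<K. q i) z = mixed_radix_value q e K"
  using assms
proof (induction K)
  case 0
  show ?case using cell_less[of 1 z] by simp
next
  case (Suc K)
  let ?c = "cell (\<Prod>i<K. q i) z" and ?r = "cell (q K) (real (\<Prod>i<K. q i) * z)" and ?v = "mixed_radix_value q e K"
  have e: "e K < q K" using Suc.prems by simp
  then have r: "?r < q K" by (intro cell_less) simp
  have "q K * ?c + ?r = q K * ?v + e K \<longleftrightarrow> ?c = ?v \<and> ?r = e K"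
  proof
    assume eq: "q K * ?c + ?r = q K * ?v + e K"
    have "(q K * ?c + ?r) div q K = ?c" "(q K * ?c + ?r) mod q K = ?r" using r e by simp_all
    moreover have "(q K * ?v + e K) div q K = ?v" "(q K * ?v + e K) mod q K = e K" using e by simp_all
    ultimately show "?c = ?v \<and> ?r = e K" unfolding eq by simp
  qed simp
  moreover have "(\<forall>i<K. cell (q i) (real (\<Prod>l<i. q l) * z) = e i) \<longleftrightarrow> ?c = ?v"
    using Suc by simp
  ultimately show ?case
    by (simp add: less_Suc_eq cell_mult all_conj_distrib imp_conjR disj_imp
        del: of_nat_prod) (blast dest: sym)
qed

lemma prod_upto_add:
  "(\<Prod>i=1..n + k. Q i) = (\<Prod>i=1..n. Q i) * (\<Prod>i<k. Q (Suc n + i) :: nat)"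
  by (induction k) (simp_all add: mult_ac)

text \<open>
  An occurrence of an admissible block is a visit to a single cell, whose length is the expected
  frequency of the block. This translates between digit counts and distribution modulo 1.
\<close>

lemma block_occurs_iff:
  assumes Q: "basic_sequence Q"
  shows "(\<forall>i<length B. cantor_digit Q x (Suc n + i) = int (B ! i)) \<longleftrightarrow>
    (\<forall>i<length B. B ! i < Q (Suc n + i)) \<and>
    cell (\<Prod>i<length B. Q (Suc n + i)) (real (\<Prod>i=1..n. Q i) * x)
      = mixed_radix_value (\<lambda>i. Q (Suc n + i)) ((!) B) (length B)"
proof -
  define q where "q i = Q (Suc n + i)" for i
  define z where "z = real (\<Prod>i=1..n. Q i) * x"
  have digit: "cantor_digit Q x (Suc n + i) = int (cell (q i) (real (\<Prod>l<i. q l) * z))" for i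
    using cantor_digit_Suc[OF Q, of x "n + i"] unfolding prod_upto_add
    by (simp add: q_def z_def mult_ac)
  have q: "q i > 0" for i using Q by (simp add: q_def basic_sequence_def less_le_trans[of 0 2])
  have "(\<forall>i<length B. cantor_digit Q x (Suc n + i) = int (B ! i)) \<longleftrightarrow>
      (\<forall>i<length B. B ! i < q i) \<and> (\<forall>i<length B. cell (q i) (real (\<Prod>l<i. q l) * z) = B ! i)"
    unfolding digit of_nat_eq_iff using cell_less[OF q] by metis
  also have "\<dots> \<longleftrightarrow> (\<forall>i<length B. B ! i < q i) \<and>
      cell (\<Prod>i<length B. q i) z = mixed_radix_value q ((!) B) (length B)"
    using cell_eq_mixed_radix_value_iff[of "length B" "(!) B" q z] by blast
  finally show ?thesis by (simp only: q_def[abs_def] z_def)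
qed

section \<open>Eventually periodic basic sequences\<close>

text \<open>
  The first \<open>d\<close> terms are the initial part, and \<open>b\<close> is the product over one period. The real
  number \<open>x\<close> is a parameter because the statements about \<open>Q\<close> below concern one fixed number.
\<close>

locale eventually_periodic_basic =
  fixes Q :: "nat \<Rightarrow> nat" and d m b :: nat and x :: real
  assumes basic: "basic_sequence Q"
    and m_pos: "m > 0"
    and periodic: "n \<ge> d \<Longrightarrow> Q (Suc n + m) = Q (Suc n)"
    and period_prod: "(\<Prod>i<m. Q (Suc d + i)) = b"
begin

definition P :: "nat \<Rightarrow> nat" where "P n = (\<Prod>i=1..n. Q i)"

lemma Q_ge_2: "Q (Suc n) \<ge> 2"
  using basic by (simp add: basic_sequence_def)

lemma P_pos: "P n > 0"
  unfolding P_def using basic by (intro prod_pos) (auto simp: basic_sequence_def less_le_trans[of 0 2])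

lemma P_add: "P (n + k) = P n * (\<Prod>i<k. Q (Suc n + i))"
  unfolding P_def by (rule prod_upto_add)

lemma b_ge_2: "b \<ge> 2"
proof -
  have "2 ^ 1 \<le> (2::nat) ^ m" using m_pos by (intro power_increasing) auto
  also have "\<dots> = (\<Prod>i<m. 2)" by simp
  also have "\<dots> \<le> (\<Prod>i<m. Q (Suc d + i))" using Q_ge_2 by (intro prod_mono) auto
  finally have "2 ^ 1 \<le> b" unfolding period_prod .
  then show ?thesis by simp
qed

lemma Q_periodic: "n \<ge> d \<Longrightarrow> Q (Suc (n + m * t)) = Q (Suc n)"
proof (induction t)
  case (Suc t)
  have "Q (Suc (n + m * Suc t)) = Q (Suc (n + m * t) + m)" by (simp add: algebra_simps)
  also have "\<dots> = Q (Suc (n + m * t))" using Suc.prems by (intro periodic) simp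
  finally show ?case using Suc by simp
qed simp

lemma window_prod_period: "n \<ge> d \<Longrightarrow> (\<Prod>i<m. Q (Suc n + i)) = b"
proof (induction n rule: dec_induct)
  case base
  show ?case by (rule period_prod)
next
  case (step n)
  have "Q (Suc n) * (\<Prod>i<m. Q (Suc (Suc n) + i)) = (\<Prod>i<Suc m. Q (Suc n + i))"
    by (subst prod.lessThan_Suc_shift) simp
  also have "\<dots> = b * Q (Suc n)" using step periodic[of n] by simp
  finally show ?case using Q_ge_2[of n] by simp
qed

lemma window_prod: "n \<ge> d \<Longrightarrow> (\<Prod>i<m * t. Q (Suc n + i)) = b ^ t"
proof (induction t)
  case (Suc t)
  have "P (n + m * Suc t) = P (n + m * t + m)" by (simp add: algebra_simps)
  also have "\<dots> = P n * b ^ t * b"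
    using Suc window_prod_period[of "n + m * t"] by (simp add: P_add)
  finally have "P n * (\<Prod>i<m * Suc t. Q (Suc n + i)) = P n * b ^ Suc t"
    unfolding P_add by (simp only: power_Suc2 mult.assoc)
  then show ?case using P_pos[of n] unfolding mult_cancel1 by simp
qed simp

lemma P_periodic: "n \<ge> d \<Longrightarrow> P (n + m * t) = P n * b ^ t"
  by (simp only: P_add window_prod)

text \<open>
  On each residue class of indices modulo the period, the orbit defining \<open>Q\<close>-distribution
  normality is the orbit of a fixed multiple of \<open>x\<close> under multiplication by \<open>b\<close>.
\<close>

lemma P_residue: "real (P (d + m * t + r)) * y = real (P (d + r)) * (real (b ^ t) * y)"
  using P_periodic[of "d + r" t] by (simp add: add_ac)

lemma uniformly_distributed_residue:
  assumes "uniformly_distributed_mod1 (\<lambda>n. real (b ^ n) * x)"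
  shows "uniformly_distributed_mod1 (\<lambda>t. real (P (d + m * t + r)) * x)"
  unfolding P_residue by (rule uniformly_distributed_nat_mult[OF P_pos assms])

text \<open>
  The common step from either notion of normality to uniform distribution in base \<open>b\<close>. It is
  enough to bound the visits at times \<open>d + m * t\<close> by a sequence \<open>f\<close> that lives on all indices
  and has a small enough mean: restricting \<open>f\<close> to one residue class and removing the factor
  \<open>P d\<close> enlarge the constant only.
\<close>

lemma uniformly_distributed_if_visits:
  assumes "\<And>k a. k > 0 \<Longrightarrow> a < b ^ k \<Longrightarrow> \<exists>f L. (\<forall>n. 0 \<le> f n) \<and> has_mean f L \<and> L \<le> 1 / real (b ^ k) \<and>
     (\<forall>t. of_bool (cell (b ^ k) (real (P (d + m * t)) * x) = a) \<le> f (d + m * t))"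
  shows "uniformly_distributed_mod1 (\<lambda>n. real (b ^ n) * x)"
proof -
  have "bounded_visits b (real (P d) * x) (4 * real m)"
    unfolding bounded_visits_def
  proof (intro allI impI)
    fix k a :: nat assume "k > 0" "a < b ^ k"
    then obtain f L where f: "\<And>n. 0 \<le> f n" "has_mean f L" "L \<le> 1 / real (b ^ k)"
      and le: "\<And>t. of_bool (cell (b ^ k) (real (P (d + m * t)) * x) = a) \<le> f (d + m * t)"
      using assms by blast
    have "1 / real (b ^ k) > 0" using b_ge_2 by simp
    from sum_progression_le_mean[OF f this m_pos, of d]
    show "\<forall>\<^sub>F N in sequentially.
        real (card {n. n < N \<and> cell (b ^ k) (real (b ^ n) * (real (P d) * x)) = a})
        \<le> 4 * real m / real (b ^ k) * real N"
    proof eventually_elim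
      fix N assume N: "(\<Sum>t<N. f (d + m * t)) \<le> 4 * real m * (1 / real (b ^ k)) * real N"
      have eq: "real (b ^ t) * (real (P d) * x) = real (P (d + m * t)) * x" for t
        using P_residue[of t 0 x] by (metis add_0_right mult.left_commute)
      have "real (card {n. n < N \<and> cell (b ^ k) (real (b ^ n) * (real (P d) * x)) = a})
          = (\<Sum>t<N. of_bool (cell (b ^ k) (real (P (d + m * t)) * x) = a))"
        unfolding eq sum_of_bool_lessThan ..
      also have "\<dots> \<le> (\<Sum>t<N. f (d + m * t))" by (intro sum_mono le)
      finally show "real (card {n. n < N \<and> cell (b ^ k) (real (b ^ n) * (real (P d) * x)) = a})
        \<le> 4 * real m / real (b ^ k) * real N" using N by simp
    qed
  qed
  then have "bounded_visits b x (real (P d) * (4 * real m))"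
    using P_pos b_ge_2 by (intro bounded_visits_of_multiple) auto
  then show ?thesis using b_ge_2 P_pos m_pos by (intro uniformly_distributed_if_bounded_visits) auto
qed

theorem Q_distribution_normal_iff:
  "Q_distribution_normal Q x \<longleftrightarrow> uniformly_distributed_mod1 (\<lambda>n. real (b ^ n) * x)"
proof -
  have Q: "Q_distribution_normal Q x \<longleftrightarrow> uniformly_distributed_mod1 (\<lambda>n. real (P n) * x)"
    by (simp add: Q_distribution_normal_def uniformly_distributed_mod1_def T_map_def P_def)
  show ?thesis unfolding Q
  proof
    assume u: "uniformly_distributed_mod1 (\<lambda>n. real (P n) * x)"
    show "uniformly_distributed_mod1 (\<lambda>n. real (b ^ n) * x)"
    proof (rule uniformly_distributed_if_visits)
      fix k a assume "a < b ^ k"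
      then show "\<exists>f L. (\<forall>n. 0 \<le> f n) \<and> has_mean f L \<and> L \<le> 1 / real (b ^ k) \<and>
          (\<forall>t. of_bool (cell (b ^ k) (real (P (d + m * t)) * x) = a) \<le> f (d + m * t))"
        using has_mean_cell_if_uniformly_distributed[OF u \<open>a < b ^ k\<close>]
        by (intro exI[of _ "\<lambda>n. of_bool (cell (b ^ k) (real (P n) * x) = a)"] exI[of _ "1 / real (b ^ k)"]) auto
    qed
  next
    assume u: "uniformly_distributed_mod1 (\<lambda>n. real (b ^ n) * x)"
    show "uniformly_distributed_mod1 (\<lambda>n. real (P n) * x)"
      unfolding uniformly_distributed_mod1_iff_has_mean
    proof (intro allI impI)
      fix \<alpha> \<beta> :: real assume \<alpha>\<beta>: "0 \<le> \<alpha>" "\<alpha> < \<beta>" "\<beta> \<le> 1"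
      have "has_mean (\<lambda>n. of_bool (\<alpha> \<le> frac (real (P n) * x) \<and> frac (real (P n) * x) < \<beta>))
          ((\<Sum>r<m. \<beta> - \<alpha>) / real m)"
        using uniformly_distributed_residue[OF u, unfolded uniformly_distributed_mod1_iff_has_mean] \<alpha>\<beta> m_pos
        by (intro has_mean_residues) auto
      then show "has_mean (\<lambda>n. of_bool (\<alpha> \<le> frac (real (P n) * x) \<and> frac (real (P n) * x) < \<beta>)) (\<beta> - \<alpha>)"
        using m_pos by simp
    qed
  qed
qed

definition block_density :: "nat list \<Rightarrow> nat \<Rightarrow> real" where
  "block_density B n = block_indicator Q (Suc n) B / real (\<Prod>i<length B. Q (Suc n + i))"

definition mean_density :: "nat list \<Rightarrow> real" where
  "mean_density B = (\<Sum>r<m. block_density B (d + r)) / real m"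

lemma expected_count_eq: "expected_count Q n B = (\<Sum>j<n. block_density B j)"
  unfolding expected_count_def block_density_def
  unfolding One_nat_def sum.atLeast1_atMost_eq ..

lemma block_density_nonneg: "0 \<le> block_density B n"
  by (simp add: block_density_def block_indicator_def flip: of_nat_prod)

lemma Q_pos: "0 < Q (Suc n + i)"
  using Q_ge_2[of "n + i"] by simp

lemma block_density_le_1: "block_density B n \<le> 1"
proof -
  have "(\<Prod>i<length B. Q (Suc n + i)) > 0" using Q_pos by (intro prod_pos) blast
  then have "1 \<le> real (\<Prod>i<length B. Q (Suc n + i))" by linarith
  then show ?thesis
    by (auto simp: block_density_def block_indicator_def divide_le_eq_1 simp del: of_nat_prod)
qed

lemma Q_window_periodic: "Q (Suc (d + m * t + r) + i) = Q (Suc (d + r) + i)"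
  using Q_periodic[of "d + r + i" t] by (simp add: add_ac)

lemma block_density_periodic: "block_density B (d + m * t + r) = block_density B (d + r)"
  by (simp only: block_density_def block_indicator_def Q_window_periodic)

lemma has_mean_block_density: "has_mean (block_density B) (mean_density B)"
  unfolding mean_density_def
proof (rule has_mean_residues[OF m_pos])
  show "\<bar>block_density B n\<bar> \<le> 1" for n
    using block_density_nonneg[of B n] block_density_le_1[of B n] by simp
  show "has_mean (\<lambda>t. block_density B (d + m * t + r)) (block_density B (d + r))" for r
    unfolding block_density_periodic by (rule has_mean_const)
qed

text \<open>
  The densities are periodic from index \<open>d\<close> on. So either they vanish there and the expected
  counts are bounded, or the expected counts grow linearly.
\<close>

lemma expected_count_at_top_iff:
  "filterlim (\<lambda>n. expected_count Q n B) at_top sequentially \<longleftrightarrow> mean_density B > 0"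
proof
  assume "mean_density B > 0"
  have "filterlim (\<lambda>n. (\<Sum>j<n. block_density B j) / real n * real n) at_top sequentially"
    using has_mean_block_density \<open>mean_density B > 0\<close> unfolding has_mean_def
    by (rule filterlim_tendsto_pos_mult_at_top) (rule filterlim_real_sequentially)
  then show "filterlim (\<lambda>n. expected_count Q n B) at_top sequentially"
  proof (rule filterlim_mono_eventually)
    show "\<forall>\<^sub>F n in sequentially. (\<Sum>j<n. block_density B j) / real n * real n = expected_count Q n B"
      by (rule eventually_sequentiallyI[of 1]) (simp add: expected_count_eq)
  qed auto
next
  assume lim: "filterlim (\<lambda>n. expected_count Q n B) at_top sequentially"
  show "mean_density B > 0"
  proof (rule ccontr)
    assume "\<not> mean_density B > 0"
    moreover have "0 \<le> (\<Sum>r<m. block_density B (d + r))" by (intro sum_nonneg block_density_nonneg)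
    ultimately have "(\<Sum>r<m. block_density B (d + r)) = 0"
      using m_pos by (simp add: mean_density_def zero_less_divide_iff)
    then have zero: "block_density B (d + r) = 0" if "r < m" for r
      using that block_density_nonneg by (subst (asm) sum_nonneg_eq_0_iff) auto
    have "block_density B (d + s) = 0" for s
      using block_density_periodic[of B "s div m" "s mod m"] zero[of "s mod m"] m_pos
      by (simp add: add.assoc)
    then have "(\<Sum>j<d + s. block_density B j) = (\<Sum>j<d. block_density B j)" for s
      by (induction s) simp_all
    then have "expected_count Q (d + s) B = expected_count Q d B" for s
      by (simp only: expected_count_eq)
    moreover from lim obtain N where "\<And>n. n \<ge> N \<Longrightarrow> expected_count Q d B + 1 \<le> expected_count Q n B"
      unfolding filterlim_at_top eventually_sequentially by blast
    then have "expected_count Q d B + 1 \<le> expected_count Q (d + N) B" by simp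
    ultimately show False by simp
  qed
qed

definition block_at :: "nat list \<Rightarrow> nat \<Rightarrow> bool" where
  "block_at B n \<longleftrightarrow> (\<forall>i<length B. cantor_digit Q x (Suc n + i) = int (B ! i))"

text \<open>
  The definition of \<open>block_count\<close> excludes occurrences which run beyond the first \<open>n\<close> digits;
  there are at most \<open>length B\<close> of them. The extra 1 in the error bound is for the empty block,
  which is also counted at the end.
\<close>

lemma block_count_mean_iff:
  "(\<lambda>n. real (block_count Q n B x) / real n) \<longlonglongrightarrow> M \<longleftrightarrow> has_mean (\<lambda>n. of_bool (block_at B n)) M"
proof -
  have err: "\<bar>real (block_count Q n B x) - (\<Sum>j<n. of_bool (block_at B j))\<bar> \<le> real (length B + 1)" for n
  proof -
    let ?S = "{j. j < n \<and> block_at B j}"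
    let ?T = "{j. j + length B \<le> n \<and> block_at B j}"
    have fin: "finite ?T" by (rule finite_subset[of _ "{..n}"]) auto
    have "{j. 1 \<le> j \<and> j + length B \<le> n + 1 \<and> (\<forall>i<length B. cantor_digit Q x (j + i) = int (B ! i))} = Suc ` ?T"
    proof (intro equalityI subsetI)
      fix j assume "j \<in> {j. 1 \<le> j \<and> j + length B \<le> n + 1 \<and> (\<forall>i<length B. cantor_digit Q x (j + i) = int (B ! i))}"
      then show "j \<in> Suc ` ?T" by (cases j) (auto simp: block_at_def)
    qed (auto simp: block_at_def)
    then have "block_count Q n B x = card ?T" by (simp add: block_count_def card_image)
    moreover have "card ?T \<le> card ?S + 1"
    proof -
      have "?T \<subseteq> insert n ?S" by auto
      then have "card ?T \<le> card (insert n ?S)" by (intro card_mono) auto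
      then show ?thesis by (simp split: if_splits)
    qed
    moreover have "card ?S \<le> card ?T + length B"
    proof -
      have "?S \<subseteq> ?T \<union> {n - length B..<n}" by auto
      then have "card ?S \<le> card (?T \<union> {n - length B..<n})" using fin by (intro card_mono) auto
      also have "\<dots> \<le> card ?T + card {n - length B..<n}" by (rule card_Un_le)
      finally show ?thesis by simp
    qed
    ultimately show ?thesis by (simp add: sum_of_bool_lessThan)
  qed
  have err': "\<bar>(\<Sum>j<n. of_bool (block_at B j)) - real (block_count Q n B x)\<bar> \<le> real (length B + 1)" for n
    using err[of n] by (simp only: abs_minus_commute)
  show ?thesis
    unfolding has_mean_def by (rule iffI) (erule mean_bounded_error, rule err' err)+
qed

text \<open>
  On one residue class the bases under the block do not change, so there the block corresponds to
  one fixed cell.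
\<close>

lemma has_mean_block_at:
  assumes u: "uniformly_distributed_mod1 (\<lambda>n. real (b ^ n) * x)"
  shows "has_mean (\<lambda>n. of_bool (block_at B n)) (mean_density B)"
  unfolding mean_density_def
proof (rule has_mean_residues[OF m_pos])
  fix r
  define q where "q i = Q (Suc (d + r) + i)" for i
  define v where "v = mixed_radix_value q ((!) B) (length B)"
  have at: "block_at B (d + m * t + r) \<longleftrightarrow> (\<forall>i<length B. B ! i < q i) \<and>
      cell (\<Prod>i<length B. q i) (real (P (d + m * t + r)) * x) = v" for t
    unfolding block_at_def block_occurs_iff[OF basic] Q_window_periodic q_def[symmetric] P_def[symmetric] v_def ..
  show "has_mean (\<lambda>t. of_bool (block_at B (d + m * t + r))) (block_density B (d + r))"
  proof (cases "\<forall>i<length B. B ! i < q i")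
    case True
    then have "v < (\<Prod>i<length B. q i)" unfolding v_def by (intro mixed_radix_value_less) auto
    from has_mean_cell_if_uniformly_distributed[OF uniformly_distributed_residue[OF u] this]
    show ?thesis using True by (simp add: at block_density_def block_indicator_def q_def)
  next
    case False
    then have "block_indicator Q (Suc (d + r)) B = 0"
      unfolding block_indicator_def q_def by (simp only: if_False)
    then have "block_density B (d + r) = 0" by (simp add: block_density_def)
    moreover have "\<not> block_at B (d + m * t + r)" for t using False at by blast
    ultimately show ?thesis using has_mean_const[of 0] by simp
  qed
qed simp

text \<open>
  From uniform distribution to \<open>Q\<close>-normality, both the actual and the expected counts have the mean
  \<open>mean_density B\<close>. Conversely, \<open>Q\<close>-normality controls only the total count of a block over all
  residue classes. For a block whose length is a multiple \<open>m * k\<close> of the period, every window has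
  the product \<open>b ^ k\<close>, so the total count is at most about \<open>n / b ^ k\<close>, and this bounds the visits
  to the corresponding cell at the times in a single class.
\<close>

theorem Q_normal_iff:
  "Q_normal Q x \<longleftrightarrow> uniformly_distributed_mod1 (\<lambda>n. real (b ^ n) * x)"
proof
  assume u: "uniformly_distributed_mod1 (\<lambda>n. real (b ^ n) * x)"
  show "Q_normal Q x"
    unfolding Q_normal_def expected_count_at_top_iff
  proof (intro allI impI)
    fix B assume pos: "mean_density B > 0"
    have "(\<lambda>n. (real (block_count Q n B x) / real n) / ((\<Sum>j<n. block_density B j) / real n))
        \<longlonglongrightarrow> mean_density B / mean_density B"
      using has_mean_block_at[OF u] has_mean_block_density pos
      by (intro tendsto_divide) (auto simp: has_mean_def block_count_mean_iff)
    moreover have "mean_density B / mean_density B = 1" using pos by simp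
    ultimately have "(\<lambda>n. (real (block_count Q n B x) / real n) / ((\<Sum>j<n. block_density B j) / real n))
        \<longlonglongrightarrow> 1" by (simp only:)
    then show "(\<lambda>n. real (block_count Q n B x) / expected_count Q n B) \<longlonglongrightarrow> 1"
    proof (rule Lim_transform_eventually)
      show "\<forall>\<^sub>F n in sequentially. real (block_count Q n B x) / real n / ((\<Sum>j<n. block_density B j) / real n)
          = real (block_count Q n B x) / expected_count Q n B"
        by (rule eventually_sequentiallyI[of 1]) (simp add: expected_count_eq)
    qed
  qed
next
  assume normal: "Q_normal Q x"
  show "uniformly_distributed_mod1 (\<lambda>n. real (b ^ n) * x)"
  proof (rule uniformly_distributed_if_visits)
    fix k a assume k: "k > 0" and a: "a < b ^ k"
    define q where "q i = Q (Suc d + i)" for i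
    have "a < (\<Prod>i<m * k. q i)" using a window_prod[of d k] by (simp add: q_def)
    then obtain B where B: "length B = m * k" "\<forall>i<m * k. B ! i < q i"
        "mixed_radix_value q ((!) B) (m * k) = a"
      using mixed_radix_value_surj by blast
    have at: "block_at B (d + m * t) \<longleftrightarrow> cell (b ^ k) (real (P (d + m * t)) * x) = a" for t
    proof -
      have Qq: "Q (Suc (d + m * t) + i) = q i" for i
        using Q_window_periodic[of t 0 i] by (simp add: q_def)
      have "(\<Prod>i<length B. q i) = b ^ k" using window_prod[of d k] by (simp add: q_def B(1))
      then show ?thesis
        unfolding block_at_def block_occurs_iff[OF basic] Qq P_def[symmetric]
        using B by simp
    qed
    have density: "block_density B (d + r) = block_indicator Q (Suc (d + r)) B / real (b ^ k)" for r
      using window_prod[of "d + r" k] by (simp add: block_density_def B(1))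
    have bk: "real (b ^ k) > 0" using b_ge_2 by simp
    \<comment> \<open>The block need not be admissible in the other residue classes, hence only an inequality.\<close>
    have "mean_density B \<le> (\<Sum>r<m. 1 / real (b ^ k)) / real m"
      unfolding mean_density_def density using bk
      by (intro divide_right_mono sum_mono) (auto simp: block_indicator_def)
    then have le: "mean_density B \<le> 1 / real (b ^ k)" using m_pos by simp
    have "block_density B (d + 0) = 1 / real (b ^ k)"
      unfolding density using B by (simp add: block_indicator_def q_def)
    moreover have "block_density B (d + 0) \<le> (\<Sum>r<m. block_density B (d + r))"
      using m_pos block_density_nonneg by (intro member_le_sum) auto
    moreover have "1 / real (b ^ k) > 0" using bk by simp
    ultimately have "(\<Sum>r<m. block_density B (d + r)) > 0" by linarith
    then have pos: "mean_density B > 0" using m_pos by (simp add: mean_density_def)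
    have "B \<noteq> []" using B(1) k m_pos by auto
    then have "(\<lambda>n. real (block_count Q n B x) / expected_count Q n B) \<longlonglongrightarrow> 1"
      using normal pos by (simp add: Q_normal_def expected_count_at_top_iff)
    moreover have "(\<lambda>n. expected_count Q n B / real n) \<longlonglongrightarrow> mean_density B"
      using has_mean_block_density by (simp add: has_mean_def expected_count_eq)
    ultimately have "(\<lambda>n. real (block_count Q n B x) / expected_count Q n B * (expected_count Q n B / real n))
        \<longlonglongrightarrow> 1 * mean_density B" by (rule tendsto_mult)
    moreover have "\<forall>\<^sub>F n in sequentially. real (block_count Q n B x) / expected_count Q n B
        * (expected_count Q n B / real n) = real (block_count Q n B x) / real n"
    proof -
      have "\<forall>\<^sub>F n in sequentially. 1 \<le> expected_count Q n B"
        using pos unfolding expected_count_at_top_iff[symmetric] filterlim_at_top by blast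
      then show ?thesis by eventually_elim simp
    qed
    ultimately have "(\<lambda>n. real (block_count Q n B x) / real n) \<longlonglongrightarrow> 1 * mean_density B"
      by (rule Lim_transform_eventually)
    then have "has_mean (\<lambda>n. of_bool (block_at B n)) (mean_density B)"
      by (simp add: block_count_mean_iff)
    then show "\<exists>f L. (\<forall>n. 0 \<le> f n) \<and> has_mean f L \<and> L \<le> 1 / real (b ^ k) \<and>
        (\<forall>t. of_bool (cell (b ^ k) (real (P (d + m * t)) * x) = a) \<le> f (d + m * t))"
      using le by (intro exI[of _ "\<lambda>n. of_bool (block_at B n)"] exI[of _ "mean_density B"]) (simp add: at)
  qed
qed

end

section \<open>Normality in multiplicatively dependent bases\<close>

lemma eventually_periodic_basic_of_list:
  assumes "basic_sequence Q" "eventually_periodic_with Q c"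
  shows "\<exists>d. eventually_periodic_basic Q d (length c) (prod_list c)"
proof -
  from assms(2) obtain d :: "nat list" where c: "c \<noteq> []" and Q: "\<forall>i. Q (length d + i + 1) = c ! (i mod length c)"
    unfolding eventually_periodic_with_def by blast
  have Qn: "Q (Suc n) = c ! ((n - length d) mod length c)" if "n \<ge> length d" for n
    using spec[OF Q, of "n - length d"] that by simp
  have "eventually_periodic_basic Q (length d) (length c) (prod_list c)"
  proof
    show "basic_sequence Q" "length c > 0" using assms c by auto
    show "Q (Suc n + length c) = Q (Suc n)" if "n \<ge> length d" for n
    proof -
      have "n + length c - length d = (n - length d) + length c" using that by simp
      from Qn[of "n + length c", unfolded this mod_add_self2] show ?thesis using Qn[of n] that by simp
    qed
    have "(\<Prod>i<length c. Q (Suc (length d) + i)) = (\<Prod>i<length c. c ! i)"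
      by (intro prod.cong) (use Q in auto)
    also have "\<dots> = prod_list c"
      by (induction c) (simp_all add: prod.lessThan_Suc_shift del: prod.lessThan_Suc)
    finally show "(\<Prod>i<length c. Q (Suc (length d) + i)) = prod_list c" .
  qed
  then show ?thesis by blast
qed

lemma constant_eventually_periodic_basic:
  assumes "g \<ge> 2" "k > 0"
  shows "eventually_periodic_basic (\<lambda>_. g) 0 k (g ^ k)"
  using assms by unfold_locales (auto simp: basic_sequence_def)

text \<open>
  For a constant sequence the expected count of a block grows without bound exactly if its
  entries are base-\<open>g\<close> digits, and then it is \<open>n / g ^ length B\<close>.
\<close>

lemma normal_in_base_iff_Q_normal:
  assumes "g \<ge> 2"
  shows "normal_in_base g x \<longleftrightarrow> Q_normal (\<lambda>_. g) x"
proof -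
  interpret eventually_periodic_basic "\<lambda>_. g" 0 "Suc 0" g x
    using constant_eventually_periodic_basic[of g "Suc 0"] assms by simp
  have density: "block_density B n = (if set B \<subseteq> {..<g} then 1 / real g ^ length B else 0)" for B n
    by (auto simp: block_density_def block_indicator_def all_set_conv_all_nth subset_iff in_set_conv_nth)
  have expected: "expected_count (\<lambda>_. g) n B = real n / real g ^ length B" if "set B \<subseteq> {..<g}" for n B
    using that by (simp add: expected_count_eq density)
  have "mean_density B > 0 \<longleftrightarrow> set B \<subseteq> {..<g}" for B
    using assms by (simp add: mean_density_def density)
  then have "Q_normal (\<lambda>_. g) x \<longleftrightarrow> (\<forall>B. B \<noteq> [] \<longrightarrow> set B \<subseteq> {..<g} \<longrightarrow>
      (\<lambda>n. real (block_count (\<lambda>_. g) n B x) / (real n / real g ^ length B)) \<longlonglongrightarrow> 1)"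
    by (simp add: Q_normal_def expected_count_at_top_iff expected)
  also have "\<dots> \<longleftrightarrow> normal_in_base g x"
    unfolding normal_in_base_def
  proof (intro all_cong1 imp_cong refl)
    fix B :: "nat list"
    have G: "real g ^ length B \<noteq> 0" using assms by simp
    have "(\<lambda>n. real (block_count (\<lambda>_. g) n B x) / (real n / real g ^ length B)) \<longlonglongrightarrow> 1 \<longleftrightarrow>
        (\<lambda>n. real g ^ length B * (real (block_count (\<lambda>_. g) n B x) / real n))
          \<longlonglongrightarrow> real g ^ length B * (1 / real g ^ length B)"
      using assms by (simp add: mult.commute)
    also have "\<dots> \<longleftrightarrow> (\<lambda>n. real (block_count (\<lambda>_. g) n B x) / real n) \<longlonglongrightarrow> 1 / real g ^ length B"
      by (rule tendsto_mult_left_iff[OF G])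
    finally show "(\<lambda>n. real (block_count (\<lambda>_. g) n B x) / (real n / real g ^ length B)) \<longlonglongrightarrow> 1 \<longleftrightarrow>
        (\<lambda>n. real (block_count (\<lambda>_. g) n B x) / real n) \<longlonglongrightarrow> 1 / real g ^ length B" .
  qed
  finally show ?thesis ..
qed

text \<open>
  The constant sequence \<open>g\<close> has period 1 and also period \<open>k\<close>; both descriptions give the same
  notion of distribution normality.
\<close>

lemma uniformly_distributed_power_base_iff:
  assumes "g \<ge> 2" "k > 0"
  shows "uniformly_distributed_mod1 (\<lambda>n. real ((g ^ k) ^ n) * x) \<longleftrightarrow>
         uniformly_distributed_mod1 (\<lambda>n. real (g ^ n) * x)"
  using eventually_periodic_basic.Q_distribution_normal_iff[OF constant_eventually_periodic_basic[OF assms], of x]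
    eventually_periodic_basic.Q_distribution_normal_iff[OF constant_eventually_periodic_basic[of g 1], of x] assms
  by simp

lemma power_eq_power_if_log_ratio_rational:
  assumes "g \<ge> 2" "b \<ge> 2" "ln (real g) / ln (real b) \<in> \<rat>"
  shows "\<exists>p q. p > 0 \<and> q > 0 \<and> g ^ q = b ^ p"
proof -
  have ln: "ln (real g) > 0" "ln (real b) > 0" using assms by auto
  obtain p q where pq: "q \<noteq> 0" "\<bar>ln (real g) / ln (real b)\<bar> = real p / real q"
    using Rats_abs_nat_div_natE[OF assms(3)] by metis
  then have eq: "ln (real g) / ln (real b) = real p / real q" using ln by simp
  then have "real q * ln (real g) = real p * ln (real b)"
    using ln pq(1) by (simp add: field_simps)
  then have "ln (real g ^ q) = ln (real b ^ p)" using assms by (simp add: ln_realpow)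
  then have "real g ^ q = real b ^ p" using assms by (subst (asm) ln_inj_iff) auto
  then have "g ^ q = b ^ p" by (metis of_nat_eq_iff of_nat_power)
  moreover have "p > 0" using eq ln pq(1) by (cases "p = 0") auto
  ultimately show ?thesis using pq(1) by blast
qed

theorem theorem1p5:
  fixes Q :: "nat \<Rightarrow> nat" and c :: "nat list" and b g :: nat and x :: real
  assumes "basic_sequence Q"
    and "eventually_periodic_with Q c"
    and "b = prod_list c"
    and "g \<ge> 2"
    and "ln (real g) / ln (real b) \<in> \<rat>"
  shows "(normal_in_base g x \<longleftrightarrow> Q_normal Q x) \<and>
         (Q_normal Q x \<longleftrightarrow> Q_distribution_normal Q x)"
proof -
  obtain d where "eventually_periodic_basic Q d (length c) b"
    using eventually_periodic_basic_of_list assms by blast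
  then interpret eventually_periodic_basic Q d "length c" b x .
  obtain p q where pq: "p > 0" "q > 0" "g ^ q = b ^ p"
    using power_eq_power_if_log_ratio_rational[OF \<open>g \<ge> 2\<close> b_ge_2 assms(5)] by blast
  have "normal_in_base g x \<longleftrightarrow> Q_normal (\<lambda>_. g) x"
    using \<open>g \<ge> 2\<close> by (rule normal_in_base_iff_Q_normal)
  \<comment> \<open>The constant sequence \<open>g\<close> is viewed as having period \<open>q\<close>, so its period product is \<open>g ^ q\<close>.\<close>
  also have "\<dots> \<longleftrightarrow> uniformly_distributed_mod1 (\<lambda>n. real ((g ^ q) ^ n) * x)"
    using constant_eventually_periodic_basic[OF \<open>g \<ge> 2\<close> pq(2)] by (rule eventually_periodic_basic.Q_normal_iff)
  also have "\<dots> \<longleftrightarrow> uniformly_distributed_mod1 (\<lambda>n. real (b ^ n) * x)"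
    unfolding pq(3) using b_ge_2 pq(1) by (rule uniformly_distributed_power_base_iff)
  finally show ?thesis using Q_normal_iff Q_distribution_normal_iff by blast
qed

end
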